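(* Let $v\in L^2(\mathbb{R}^2;\mathbb{R}^2)\cap \mathcal{C}^1(\mathbb{R}^2;\mathbb{R}^2)$ be a (classical) solution of the stationary Euler equations $$v\cdot\nabla v=-\nabla p,\qquad \operatorname{div} v=0\qquad\text{in }\mathbb{R}^2,$$ for some pressure $p$, let $u$ be the corresponding stream function, and let $\mathbf S=\{x\in\mathbb{R}^2: v(x)=0\}$ be the stagnation set. Then: (A1) $v$ has at least one stagnation point, i.e. $\mathbf S\neq\emptyset$. (A2) If $\mathbf S\neq\mathbb{R}^2$ and $\mathbf S$ is connected, then, after possibly replacing $u$ by $-u$ and adding a constant to it, the following hold: i) $u(x)=1=\max_{\mathbb{R}^2}u$ for all $x\in\mathbf S$; ii) $\lim_{|x|\to+\infty}u(x)=\inf_{\mathbb{R}^2}u=L$ for some $L\in[-\infty,1)$; iii) $u$ solves $-\Delta u=f(u)$ in $\mathbb{R}^2$ for some $f\in\mathcal{C}^0((L,1])$.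
   Context: A classical solution means $v=(v_1,v_2)\in\mathcal{C}^1$ satisfying the equations pointwise, with $p$ a scalar function determined up to an additive constant. Since $\operatorname{div}v=0$ in $\mathbb{R}^2$, there is a function $u:\mathbb{R}^2\to\mathbb{R}$, unique up to an additive constant, called the stream function, with $v=(\nabla u)^\perp=(-\partial_{x_2}u,\partial_{x_1}u)$. In particular $u\in\mathcal{C}^2(\mathbb{R}^2)$ and $\mathbf S=\{\nabla u=0\}$. *)

theory Defs
  imports "HOL-Analysis.Analysis"
begin

definition partial_deriv :: "'n::finite \<Rightarrow> (real^'n \<Rightarrow> 'b::real_normed_vector) \<Rightarrow> real^'n \<Rightarrow> 'b"
  where "partial_deriv i f x = frechet_derivative f (at x) (axis i 1)"

definition C1 :: "(real^'n::finite \<Rightarrow> 'b::real_normed_vector) \<Rightarrow> bool"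
  where "C1 f \<longleftrightarrow> (\<forall>x. f differentiable (at x)) \<and> (\<forall>i. continuous_on UNIV (partial_deriv i f))"

definition L2 :: "(real^'n::finite \<Rightarrow> real^'m::finite) \<Rightarrow> bool"
  where "L2 f \<longleftrightarrow> f \<in> borel_measurable lborel \<and> integrable lborel (\<lambda>x. (norm (f x))\<^sup>2)"

definition divergence :: "(real^'n::finite \<Rightarrow> real^'n) \<Rightarrow> real^'n \<Rightarrow> real"
  where "divergence v x = (\<Sum>i\<in>UNIV. partial_deriv i v x $ i)"

definition advection :: "(real^'n::finite \<Rightarrow> real^'n) \<Rightarrow> real^'n \<Rightarrow> real^'n"
  where "advection v x = (\<Sum>j\<in>UNIV. v x $ j *\<^sub>R partial_deriv j v x)"

definition laplacian :: "(real^'n::finite \<Rightarrow> real) \<Rightarrow> real^'n \<Rightarrow> real"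
  where "laplacian u x = (\<Sum>i\<in>UNIV. partial_deriv i (partial_deriv i u) x)"

definition stationary_euler :: "(real^2 \<Rightarrow> real^2) \<Rightarrow> (real^2 \<Rightarrow> real) \<Rightarrow> bool"
  where "stationary_euler v p \<longleftrightarrow>
    (\<forall>x. (\<exists>g. GDERIV p x :> g \<and> advection v x = - g) \<and> divergence v x = 0)"

definition perp :: "real^2 \<Rightarrow> real^2"
  where "perp g = vector [- g $ 2, g $ 1]"

text \<open>Stream functions of \<open>v\<close> are unique only up to an additive constant, hence a predicate.
  No regularity beyond differentiability is asked for: if \<open>v\<close> is \<open>C\<^sup>1\<close>, every stream
  function of \<open>v\<close> is \<open>C\<^sup>2\<close>.\<close>

definition stream_function :: "(real^2 \<Rightarrow> real) \<Rightarrow> (real^2 \<Rightarrow> real^2) \<Rightarrow> bool"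
  where "stream_function u v \<longleftrightarrow> (\<forall>x. \<exists>g. GDERIV u x :> g \<and> v x = perp g)"

definition stagnation_set :: "(real^2 \<Rightarrow> real^2) \<Rightarrow> (real^2) set"
  where "stagnation_set v = {x. v x = 0}"

end

(*
  Let u be the stream function. By Fubini, the energy on the boundary of the square of half-side r
  is o(1/r) along a sequence of radii, so by Cauchy-Schwarz the oscillation of u on these boundaries
  tends to 0. If u had no critical point, its maximum and minimum on each such square would be
  attained on the boundary, and u would be constant.

  If the critical set S is connected, u is constant on S by Sard's theorem for C^2 functions. The
  same boundary argument shows that S is bounded, that (up to sign) this constant is the maximum of
  u, and that u tends to its infimum L. For L < t < max u, every component of {u >= t} contains a
  maximum of u and every component of {u <= t} is unbounded, so both sets are connected; by
  unicoherence of the plane so is the level set {u = t}. The Bernoulli function h = p + |v|^2/2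
  satisfies grad h = omega grad u, hence is constant on level sets: h = H(u) and omega = H'(u).
*)
theory Submission
  imports Defs
begin

section \<open>Calculus for \<open>C\<^sup>1\<close> maps and gradients\<close>

text \<open>The usual derivation of omega = f(u) from v . grad omega = 0 differentiates the
  vorticity, which is merely continuous here. Hence the detour through the Bernoulli function:
  \<open>h\<close> is followed along level sets, and omega is recovered as a one-sided derivative of
  \<open>H\<close> along a gradient ray. This says nothing at the value 1, where the gradient
  vanishes and the critical set may even have interior. At boundary points of the critical set omega
  is compared with its values on nearby lower levels; on the interior it is zero because
  \<open>v\<close> vanishes on an open set; frontier points of the interior link the two cases. Sard
  is used because a connected set of critical points need not contain any rectifiable path along
  which the zero gradient could be integrated. C^2 is the classical smoothness for real functions of
  two variables. The energy controls \<open>u\<close> only on the boundaries of selected squares.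
  Everything between them comes from one principle: an extremum over a compact set lies on its
  frontier or is a critical point.\<close>

lemma C1_has_derivative:
  fixes f :: "real^'n \<Rightarrow> 'b::real_normed_vector"
  assumes "C1 f"
  shows "(f has_derivative (\<lambda>h. \<Sum>i\<in>UNIV. h $ i *\<^sub>R partial_deriv i f x)) (at x)"
proof -
  have D: "(f has_derivative frechet_derivative f (at x)) (at x)"
    using assms frechet_derivative_works unfolding C1_def by blast
  have "frechet_derivative f (at x) h = (\<Sum>i\<in>UNIV. h $ i *\<^sub>R partial_deriv i f x)" for h
  proof -
    have l: "linear (frechet_derivative f (at x))" using D has_derivative_linear by blast
    have "frechet_derivative f (at x) h = frechet_derivative f (at x) (\<Sum>i\<in>UNIV. h $ i *\<^sub>R axis i 1)"
      by (metis basis_expansion scalar_mult_eq_scaleR)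
    also have "\<dots> = (\<Sum>i\<in>UNIV. h $ i *\<^sub>R frechet_derivative f (at x) (axis i 1))"
      by (simp add: linear_sum[OF l] linear_cmul[OF l])
    finally show ?thesis by (simp add: partial_deriv_def)
  qed
  then have "frechet_derivative f (at x) = (\<lambda>h. \<Sum>i\<in>UNIV. h $ i *\<^sub>R partial_deriv i f x)"
    by blast
  then show ?thesis using D by simp
qed

lemma partial_deriv_eq:
  "(f has_derivative D) (at x) \<Longrightarrow> partial_deriv i f x = D (axis i 1)"
  unfolding partial_deriv_def by (metis frechet_derivative_at)

lemma C1_continuous: "C1 f \<Longrightarrow> continuous_on A f"
  using C1_has_derivative has_derivative_continuous
  by (blast intro: continuous_at_imp_continuous_on)

lemma partial_deriv_bounded_linear:
  assumes "C1 f" "bounded_linear T"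
  shows "partial_deriv i (\<lambda>x. T (f x)) x = T (partial_deriv i f x)"
proof -
  have "(f has_derivative frechet_derivative f (at x)) (at x)"
    using assms(1) frechet_derivative_works unfolding C1_def by blast
  from bounded_linear.has_derivative[OF assms(2) this]
  show ?thesis by (simp add: partial_deriv_eq) (simp add: partial_deriv_def)
qed

lemma C1_bounded_linear:
  assumes "C1 f" "bounded_linear T"
  shows "C1 (\<lambda>x. T (f x))"
  unfolding C1_def
proof (intro conjI allI)
  fix x show "(\<lambda>x. T (f x)) differentiable at x"
    using bounded_linear.has_derivative[OF assms(2) C1_has_derivative[OF assms(1)]]
    unfolding differentiable_def by blast
next
  fix i show "continuous_on UNIV (partial_deriv i (\<lambda>x. T (f x)))"
    unfolding partial_deriv_bounded_linear[OF assms, abs_def]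
    using assms unfolding C1_def by (auto intro: bounded_linear.continuous_on)
qed

section \<open>Ascent along the gradient and extrema on compact sets\<close>

lemma gderiv_ray:
  assumes "GDERIV w x :> g"
  shows "((\<lambda>r. w (x + r *\<^sub>R v)) has_real_derivative (v \<bullet> g)) (at 0)"
proof -
  have "((\<lambda>r. x + r *\<^sub>R v) has_derivative (\<lambda>r. r *\<^sub>R v)) (at 0)"
    by (auto intro!: derivative_eq_intros)
  moreover have "(w has_derivative (\<lambda>h. h \<bullet> g)) (at (x + 0 *\<^sub>R v))"
    using assms by (simp add: gderiv_def)
  ultimately have "((\<lambda>r. w (x + r *\<^sub>R v)) has_derivative (\<lambda>r. (r *\<^sub>R v) \<bullet> g)) (at 0)"
    by (rule has_derivative_compose)
  then show ?thesis by (simp add: has_field_derivative_def mult.commute[of _ "v \<bullet> g"] mult_commute_abs)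
qed

lemma gderiv_ascent:
  assumes "GDERIV w x :> g" "g \<noteq> 0"
  obtains d where "d > 0" "\<And>r. 0 < r \<Longrightarrow> r < d \<Longrightarrow> w (x + r *\<^sub>R g) > w x"
  using DERIV_pos_inc_right[OF gderiv_ray[OF assms(1), of g]] assms(2) by auto

lemma gderiv_eq_0_at_max:
  fixes w :: "'a::real_inner \<Rightarrow> real"
  assumes "GDERIV w x :> g" "\<forall>\<^sub>F y in nhds x. w y \<le> w x"
  shows "g = 0"
proof (rule ccontr)
  assume "g \<noteq> 0"
  then obtain d where "d > 0" and d: "\<And>r. 0 < r \<Longrightarrow> r < d \<Longrightarrow> w (x + r *\<^sub>R g) > w x"
    using gderiv_ascent assms(1) by blast
  obtain e where "e > 0" and e: "\<And>y. dist y x < e \<Longrightarrow> w y \<le> w x"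
    using assms(2) unfolding eventually_nhds_metric by blast
  define r where "r = min (d / 2) (e / (2 * norm g))"
  have "0 < r" "r < d" "r * norm g < e"
    using \<open>d > 0\<close> \<open>e > 0\<close> \<open>g \<noteq> 0\<close> by (auto simp: r_def min_def field_simps)
  then show False
    using d[of r] e[of "x + r *\<^sub>R g"] by (auto simp: dist_norm)
qed

text \<open>The disjunction is used by excluding one side: either \<open>A\<close> has no critical
  points, or their value is known, so that the extremum is governed by the values on the
  frontier.\<close>

lemma gderiv_compact_max:
  fixes w :: "'a::real_inner \<Rightarrow> real"
  assumes w: "\<And>x. GDERIV w x :> g x" and A: "compact A" "A \<noteq> {}"
  obtains z where "z \<in> A" "\<And>y. y \<in> A \<Longrightarrow> w y \<le> w z" "z \<in> frontier A \<or> g z = 0"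
proof -
  have "continuous_on A w"
    using w has_derivative_continuous unfolding gderiv_def
    by (blast intro: continuous_at_imp_continuous_on)
  then obtain z where z: "z \<in> A" "\<And>y. y \<in> A \<Longrightarrow> w y \<le> w z"
    using continuous_attains_sup[OF A] by blast
  have "g z = 0" if "z \<notin> frontier A"
  proof (rule gderiv_eq_0_at_max[OF w])
    have "z \<in> interior A" using z(1) that closure_subset by (auto simp: frontier_def)
    then have "\<forall>\<^sub>F y in nhds z. y \<in> interior A"
      by (simp add: eventually_nhds_in_open)
    then show "\<forall>\<^sub>F y in nhds z. w y \<le> w z"
      by eventually_elim (use z(2) interior_subset in blast)
  qed
  then show ?thesis using that z by blast
qed

lemma gderiv_compact_min:
  fixes w :: "'a::real_inner \<Rightarrow> real"
  assumes w: "\<And>x. GDERIV w x :> g x" and A: "compact A" "A \<noteq> {}"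
  obtains z where "z \<in> A" "\<And>y. y \<in> A \<Longrightarrow> w z \<le> w y" "z \<in> frontier A \<or> g z = 0"
  using gderiv_compact_max[of "\<lambda>x. - w x" "\<lambda>x. - g x", OF GDERIV_minus[OF w] A] by auto

text \<open>Mean value inequality on a ball where the gradient is within \<open>e\<close> of
  \<open>g x\<close>. Comparing two arbitrary nearby points, not only a point with \<open>x\<close>,
  is what lets this replace the implicit function theorem below.\<close>

lemma gderiv_strict:
  fixes w :: "'a::euclidean_space \<Rightarrow> real"
  assumes w: "\<And>x. GDERIV w x :> g x" and g: "isCont g x" and "e > 0"
  obtains d where "d > 0" "\<And>y z. y \<in> ball x d \<Longrightarrow> z \<in> ball x d \<Longrightarrow>
    \<bar>w y - w z - (y - z) \<bullet> g x\<bar> \<le> e * norm (y - z)"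
proof -
  obtain d where "d > 0" and d: "\<And>y. dist y x < d \<Longrightarrow> dist (g y) (g x) < e"
    using g \<open>e > 0\<close> unfolding continuous_at_eps_delta by blast
  show ?thesis
  proof
    show "d > 0" by fact
    fix y z assume yz: "y \<in> ball x d" "z \<in> ball x d"
    have "norm (w y - w z - (y - z) \<bullet> g x) \<le> norm (y - z) * e"
    proof (rule differentiable_bound_linearization[where S="ball x d" and f=w and f'="\<lambda>p h. h \<bullet> g p"])
      fix t :: real assume "t \<in> {0..1}"
      then have "z + t *\<^sub>R (y - z) \<in> closed_segment z y"
        by (auto simp: closed_segment_def algebra_simps intro!: exI[of _ t])
      then show "z + t *\<^sub>R (y - z) \<in> ball x d"
        using yz by (meson convex_ball closed_segment_subset subsetD)
    next
      fix p show "(w has_derivative (\<lambda>h. h \<bullet> g p)) (at p within ball x d)"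
        using w[of p] unfolding gderiv_def by (rule has_derivative_at_withinI)
    next
      fix p assume p: "p \<in> ball x d"
      have "onorm (\<lambda>h. h \<bullet> (g p - g x)) \<le> e"
      proof (rule onorm_le)
        fix h
        have "norm (h \<bullet> (g p - g x)) \<le> norm h * norm (g p - g x)"
          by (simp add: Cauchy_Schwarz_ineq2)
        also have "\<dots> \<le> norm h * e"
          using d[of p] p by (intro mult_left_mono) (auto simp: dist_norm norm_minus_commute)
        finally show "norm (h \<bullet> (g p - g x)) \<le> e * norm h" by (simp add: mult.commute)
      qed
      then show "onorm ((\<lambda>h. h \<bullet> g p) - (\<lambda>h. h \<bullet> g x)) \<le> e"
        by (simp add: fun_diff_def inner_diff_right)
    qed (use \<open>d > 0\<close> in auto)
    then show "\<bar>w y - w z - (y - z) \<bullet> g x\<bar> \<le> e * norm (y - z)"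
      by (simp add: mult.commute)
  qed
qed

text \<open>Near a regular point the level set is a Lipschitz graph over the tangent space, so it
  contains a Lipschitz path between any two of its points; \<open>h\<close> has zero derivative along it.\<close>

lemma locally_constant_on_level_set:
  fixes w h :: "'a::euclidean_space \<Rightarrow> real"
  assumes w: "\<And>x. GDERIV w x :> g x" and h: "\<And>x. GDERIV h x :> W x *\<^sub>R g x"
    and g: "isCont g x" and nz: "g x \<noteq> 0"
  shows "\<forall>\<^sub>F y in nhds x. w y = w x \<longrightarrow> h y = h x"
proof -
  define a where "a = g x"
  have a0: "norm a > 0" using nz by (simp add: a_def)
  have aa: "a \<bullet> a = norm a * norm a" by (simp add: norm_eq_sqrt_inner)
  \<comment> \<open>Any factor well below \<open>norm a\<close> would do; a quarter leaves room for
    the sign change at distance \<open>R\<close> and for absorbing the error term in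
    \<open>lip\<close>.\<close>
  obtain d where "d > 0" and d: "\<And>y z. y \<in> ball x d \<Longrightarrow> z \<in> ball x d \<Longrightarrow>
      \<bar>w y - w z - (y - z) \<bullet> a\<bar> \<le> (norm a / 4) * norm (y - z)"
    using gderiv_strict[OF w g, of "norm a / 4"] a0 unfolding a_def by auto
  have contw: "continuous_on A w" for A
    using w has_derivative_continuous unfolding gderiv_def
    by (blast intro: continuous_at_imp_continuous_on)
  have "h y = h x" if y: "dist y x < d / 4" and eq: "w y = w x" for y
  proof -
    \<comment> \<open>Split \<open>y - x\<close> into a tangential part \<open>p\<close> and a
      multiple of the gradient \<open>a\<close>. In \<open>P s r\<close>, \<open>s\<close> runs
      along \<open>p\<close> and \<open>r\<close> is the height of the graph.\<close>
    define r1 where "r1 = ((y - x) \<bullet> a) / (a \<bullet> a)"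
    define p where "p = (y - x) - r1 *\<^sub>R a"
    have pa: "p \<bullet> a = 0" using nz by (simp add: p_def r1_def inner_diff_left a_def)
    have yx: "y = x + 1 *\<^sub>R p + r1 *\<^sub>R a" by (simp add: p_def)
    have pyth: "(norm (s *\<^sub>R p + r *\<^sub>R a))\<^sup>2 = (s * norm p)\<^sup>2 + (r * norm a)\<^sup>2" for s r
      using pa unfolding power2_norm_eq_inner power_mult_distrib
      by (simp add: inner_add_left inner_add_right inner_commute power2_eq_square)
    have ynorm: "norm (1 *\<^sub>R p + r1 *\<^sub>R a) < d / 4"
      using y yx by (simp add: dist_norm algebra_simps)
    have pn: "norm p < d / 4"
    proof -
      have "norm p ^ 2 \<le> norm (1 *\<^sub>R p + r1 *\<^sub>R a) ^ 2" using pyth[of 1 r1] by simp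
      then show ?thesis using ynorm power2_le_imp_le norm_ge_zero by (meson le_less_trans)
    qed
    have r1n: "\<bar>r1\<bar> * norm a < d / 4"
    proof -
      have "(\<bar>r1\<bar> * norm a) ^ 2 \<le> norm (1 *\<^sub>R p + r1 *\<^sub>R a) ^ 2" using pyth[of 1 r1]
        by (simp add: power_mult_distrib)
      then show ?thesis using ynorm power2_le_imp_le norm_ge_zero by (meson le_less_trans)
    qed
    define P where "P s r = x + s *\<^sub>R p + r *\<^sub>R a" for s r
    \<comment> \<open>At height \<open>R\<close> the linear term is \<open>norm a * d / 4\<close>,
      larger than the error in \<open>est\<close> because both \<open>norm p\<close> and
      \<open>R * norm a\<close> are at most \<open>d / 4\<close>. So \<open>w - w x\<close> changes
      sign between heights \<open>-R\<close> and \<open>R\<close>.\<close>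
    define R where "R = d / (4 * norm a)"
    have R: "R > 0" "R * norm a = d / 4" using \<open>d > 0\<close> a0 by (auto simp: R_def)
    have inb: "P s r \<in> ball x d" if "s \<in> {0..1}" "\<bar>r\<bar> \<le> R" for s r
    proof -
      have "norm (s *\<^sub>R p + r *\<^sub>R a) \<le> \<bar>s\<bar> * norm p + \<bar>r\<bar> * norm a"
        using norm_triangle_ineq[of "s *\<^sub>R p" "r *\<^sub>R a"] by simp
      also have "\<dots> \<le> 1 * norm p + R * norm a"
        using that by (intro add_mono mult_right_mono) auto
      also have "\<dots> < d" using R(2) pn \<open>d > 0\<close> by simp
      finally have "norm (s *\<^sub>R p + r *\<^sub>R a) < d" .
      moreover have "dist x (P s r) = norm (s *\<^sub>R p + r *\<^sub>R a)"
        using norm_minus_cancel[of "s *\<^sub>R p + r *\<^sub>R a"] by (simp add: P_def dist_norm add.assoc)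
      ultimately show ?thesis by simp
    qed
    have est: "\<bar>w (P s r) - w (P s' r') - (r - r') * (norm a * norm a)\<bar>
        \<le> (norm a / 4) * (\<bar>s - s'\<bar> * norm p + \<bar>r - r'\<bar> * norm a)"
      if "s \<in> {0..1}" "\<bar>r\<bar> \<le> R" "s' \<in> {0..1}" "\<bar>r'\<bar> \<le> R" for s r s' r'
    proof -
      have PP: "P s r - P s' r' = (s - s') *\<^sub>R p + (r - r') *\<^sub>R a"
        by (simp add: P_def algebra_simps)
      have "norm (P s r - P s' r') \<le> \<bar>s - s'\<bar> * norm p + \<bar>r - r'\<bar> * norm a"
        unfolding PP using norm_triangle_ineq[of "(s - s') *\<^sub>R p" "(r - r') *\<^sub>R a"] by simp
      then have "norm a / 4 * norm (P s r - P s' r') \<le> norm a / 4 * (\<bar>s - s'\<bar> * norm p + \<bar>r - r'\<bar> * norm a)"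
        by (intro mult_left_mono) auto
      moreover have "(P s r - P s' r') \<bullet> a = (r - r') * (norm a * norm a)"
        unfolding PP by (simp add: inner_add_left pa aa)
      ultimately show ?thesis
        using d[OF inb[OF that(1,2)] inb[OF that(3,4)]] by simp
    qed
    have ex: "\<exists>r. \<bar>r\<bar> \<le> R \<and> w (P s r) = w x" if s: "s \<in> {0..1}" for s
    proof -
      have P0: "P 0 0 = x" by (simp add: P_def)
      have sp: "\<bar>s\<bar> * norm p < d / 4" using s pn mult_right_mono[of "\<bar>s\<bar>" 1 "norm p"] by auto
      have Ra: "R * (norm a * norm a) = norm a * (d / 4)" using R(2) by (simp add: algebra_simps)
      have "norm a / 4 * (\<bar>s\<bar> * norm p + R * norm a) < norm a / 4 * d"
        by (rule mult_strict_left_mono) (use sp R(2) a0 \<open>d > 0\<close> in auto)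
      then have b: "norm a / 4 * (\<bar>s\<bar> * norm p + R * norm a) \<le> R * (norm a * norm a)"
        by (simp add: Ra)
      have "w (P s (-R)) \<le> w x"
        using est[of s "-R" 0 0] s R(1) b P0 by (smt (verit) mult_minus_left abs_le_iff atLeastAtMost_iff)
      moreover have "w x \<le> w (P s R)"
        using est[of s "R" 0 0] s R(1) b P0 by (smt (verit) mult_minus_left abs_le_iff atLeastAtMost_iff)
      moreover have "continuous_on {-R..R} (\<lambda>r. w (P s r))"
        unfolding P_def by (intro continuous_on_compose2[OF contw[of UNIV]] continuous_intros) auto
      ultimately show ?thesis
        using IVT'[of "\<lambda>r. w (P s r)" "-R" "w x" R] R(1) by (auto simp: abs_le_iff)
    qed
    then obtain r where r: "\<And>s. s \<in> {0..1} \<Longrightarrow> \<bar>r s\<bar> \<le> R" "\<And>s. s \<in> {0..1} \<Longrightarrow> w (P s (r s)) = w x"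
      by metis
    \<comment> \<open>With equal values of \<open>w\<close>, a quarter of the left side reappears on
      the right and is absorbed, which turns 1/4 into 1/3. For \<open>s = s'\<close> this is
      uniqueness of the height.\<close>
    have lip: "\<bar>q - q'\<bar> * norm a \<le> \<bar>s - s'\<bar> * norm p / 3"
      if "s \<in> {0..1}" "\<bar>q\<bar> \<le> R" "s' \<in> {0..1}" "\<bar>q'\<bar> \<le> R" "w (P s q) = w (P s' q')" for s q s' q'
    proof -
      have "\<bar>q - q'\<bar> * (norm a * norm a) \<le> (norm a / 4) * (\<bar>s - s'\<bar> * norm p + \<bar>q - q'\<bar> * norm a)"
        using est[OF that(1-4)] that(5) by (simp add: abs_mult)
      then have "norm a * (\<bar>q - q'\<bar> * norm a) \<le> norm a * ((\<bar>s - s'\<bar> * norm p + \<bar>q - q'\<bar> * norm a) / 4)"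
        by (simp add: algebra_simps)
      then have "\<bar>q - q'\<bar> * norm a \<le> (\<bar>s - s'\<bar> * norm p + \<bar>q - q'\<bar> * norm a) / 4"
        using a0 by (simp only: mult_le_cancel_left_pos)
      then show ?thesis by (simp add: mult.commute)
    qed
    have uniq: "q = q'" if "s \<in> {0..1}" "\<bar>q\<bar> \<le> R" "\<bar>q'\<bar> \<le> R" "w (P s q) = w (P s q')" for s q q'
    proof -
      have "\<bar>q - q'\<bar> * norm a \<le> 0" using lip[of s q s q'] that by simp
      then show ?thesis using a0 by (simp add: mult_le_0_iff)
    qed
    have r0: "r 0 = 0"
      using uniq[of 0 "r 0" 0] r[of 0] R(1) by (simp add: P_def)
    have r1: "r 1 = r1"
    proof -
      have "\<bar>r1\<bar> * norm a \<le> R * norm a" using r1n R(2) by simp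
      then have "\<bar>r1\<bar> \<le> R" using a0 by (simp only: mult_le_cancel_right_pos)
      moreover have "w (P 1 r1) = w x" using eq yx by (simp add: P_def)
      ultimately show ?thesis using uniq[of 1 "r 1" r1] r[of 1] by simp
    qed
    define \<gamma> where "\<gamma> s = P s (r s)" for s
    have lipg: "norm (\<gamma> s' - \<gamma> s) \<le> 2 * d * \<bar>s' - s\<bar>" if "s \<in> {0..1}" "s' \<in> {0..1}" for s s'
    proof -
      have "\<gamma> s' - \<gamma> s = (s' - s) *\<^sub>R p + (r s' - r s) *\<^sub>R a"
        by (simp add: \<gamma>_def P_def algebra_simps)
      then have "norm (\<gamma> s' - \<gamma> s) \<le> \<bar>s' - s\<bar> * norm p + \<bar>r s' - r s\<bar> * norm a"
        using norm_triangle_ineq[of "(s' - s) *\<^sub>R p" "(r s' - r s) *\<^sub>R a"] by simp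
      also have "\<dots> \<le> \<bar>s' - s\<bar> * norm p + \<bar>s' - s\<bar> * norm p / 3"
        using lip[of s' "r s'" s "r s"] r that by (simp add: mult.commute)
      also have "\<dots> \<le> 2 * (\<bar>s' - s\<bar> * norm p)" by simp
      also have "\<dots> \<le> 2 * (\<bar>s' - s\<bar> * d)"
        using pn \<open>d > 0\<close> by (intro mult_left_mono) auto
      finally show ?thesis by (simp add: algebra_simps)
    qed
    have "((\<lambda>s. h (\<gamma> s)) has_derivative (\<lambda>_. 0)) (at s within {0..1})" if s: "s \<in> {0..1}" for s
      unfolding has_derivative_within_alt
    proof (intro conjI allI impI bounded_linear_zero)
      fix e :: real assume "e > 0"
      \<comment> \<open>Freezing the factor \<open>W\<close> at \<open>\<gamma> s\<close> makes the
        derivative of \<open>D\<close> vanish there. As \<open>w\<close> is constant on the path,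
        increments of \<open>h\<close> and \<open>D\<close> along it agree, and the Lipschitz bound
        on \<open>\<gamma>\<close> turns o(|z - \<open>\<gamma> s\<close>|) into o(|s' -
        s|).\<close>
      define D where "D z = h z - W (\<gamma> s) * w z" for z
      have "GDERIV D (\<gamma> s) :> (W (\<gamma> s) *\<^sub>R g (\<gamma> s) - (W (\<gamma> s) *\<^sub>R g (\<gamma> s) + w (\<gamma> s) *\<^sub>R 0))"
        unfolding D_def by (intro GDERIV_diff h GDERIV_mult GDERIV_const w)
      then have "(D has_derivative (\<lambda>_. 0)) (at (\<gamma> s))"
        by (simp add: gderiv_def)
      then obtain \<delta> where "\<delta> > 0" and \<delta>: "\<And>z. norm (z - \<gamma> s) < \<delta> \<Longrightarrow>
          norm (D z - D (\<gamma> s)) \<le> e / (2 * d) * norm (z - \<gamma> s)"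
        unfolding has_derivative_at_alt using \<open>e > 0\<close> \<open>d > 0\<close>
        by (metis diff_zero divide_pos_pos mult_pos_pos zero_less_numeral)
      show "\<exists>\<delta>>0. \<forall>s'\<in>{0..1}. norm (s' - s) < \<delta> \<longrightarrow>
          norm (h (\<gamma> s') - h (\<gamma> s) - 0) \<le> e * norm (s' - s)"
      proof (intro exI[of _ "\<delta> / (2 * d)"] conjI ballI impI)
        show "\<delta> / (2 * d) > 0" using \<open>\<delta> > 0\<close> \<open>d > 0\<close> by simp
        fix s' :: real assume s': "s' \<in> {0..1}" and lt: "norm (s' - s) < \<delta> / (2 * d)"
        have l: "norm (\<gamma> s' - \<gamma> s) \<le> 2 * d * \<bar>s' - s\<bar>" using lipg s s' by blast
        also have "\<dots> < \<delta>" using lt \<open>d > 0\<close> by (simp add: field_simps)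
        finally have "norm (D (\<gamma> s') - D (\<gamma> s)) \<le> e / (2 * d) * norm (\<gamma> s' - \<gamma> s)"
          by (rule \<delta>)
        also have "\<dots> \<le> e / (2 * d) * (2 * d * \<bar>s' - s\<bar>)"
          using l \<open>e > 0\<close> \<open>d > 0\<close> by (intro mult_left_mono) auto
        also have "\<dots> = e * \<bar>s' - s\<bar>" using \<open>d > 0\<close> by simp
        finally show "norm (h (\<gamma> s') - h (\<gamma> s) - 0) \<le> e * norm (s' - s)"
          using r(2)[OF s] r(2)[OF s'] by (simp add: D_def \<gamma>_def)
      qed
    qed
    then obtain c where "\<And>s. s \<in> {0..1} \<Longrightarrow> h (\<gamma> s) = c"
      using has_derivative_zero_constant[of "{0..1::real}" "\<lambda>s. h (\<gamma> s)"] by auto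
    then have "h (\<gamma> 1) = h (\<gamma> 0)" by simp
    then show ?thesis using yx r0 r1 by (simp add: \<gamma>_def P_def)
  qed
  moreover have "d / 4 > 0" using \<open>d > 0\<close> by simp
  ultimately show ?thesis
    unfolding eventually_nhds_metric by blast
qed

text \<open>On the ray from \<open>x\<close> along \<open>g x\<close>, \<open>w\<close> and
  \<open>h\<close> have derivatives |g|^2 and c |g|^2, so their increments have ratio tending to
  \<open>c\<close>; and \<open>w\<close> takes every value slightly above \<open>w x\<close> on a
  short piece of this ray. Thus \<open>c\<close> is the right derivative of \<open>H\<close> at
  \<open>w x\<close>, a quantity that depends on \<open>x\<close> only through
  \<open>w x\<close>.\<close>

lemma quotient_tendsto_along_gradient:
  fixes w h :: "'a::real_inner \<Rightarrow> real"
  assumes w: "\<And>x. GDERIV w x :> g x" and h: "GDERIV h x :> c *\<^sub>R g x" and nz: "g x \<noteq> 0"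
    and H: "\<And>z. w z > w x \<Longrightarrow> w z < b \<Longrightarrow> h z = H (w z)" "h x = H (w x)" "w x < b"
  shows "((\<lambda>t. (H t - H (w x)) / (t - w x)) \<longlongrightarrow> c) (at_right (w x))"
proof -
  define \<psi> where "\<psi> r = w (x + r *\<^sub>R g x)" for r
  define \<xi> where "\<xi> r = h (x + r *\<^sub>R g x)" for r
  have contw: "continuous_on A w" for A
    using w has_derivative_continuous unfolding gderiv_def
    by (blast intro: continuous_at_imp_continuous_on)
  have cont: "continuous_on A \<psi>" for A
    unfolding \<psi>_def by (intro continuous_on_compose2[OF contw[of UNIV]] continuous_intros) auto
  have 1: "((\<lambda>r. (\<psi> r - \<psi> 0) / (r - 0)) \<longlongrightarrow> g x \<bullet> g x) (at_right 0)"
    using gderiv_ray[OF w, of x "g x"] unfolding \<psi>_def has_field_derivative_iff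
    by (auto intro: tendsto_mono[OF at_le])
  have 2: "((\<lambda>r. (\<xi> r - \<xi> 0) / (r - 0)) \<longlongrightarrow> g x \<bullet> (c *\<^sub>R g x)) (at_right 0)"
    using gderiv_ray[OF h, of "g x"] unfolding \<xi>_def has_field_derivative_iff
    by (auto intro: tendsto_mono[OF at_le])
  have "((\<lambda>r. ((\<xi> r - \<xi> 0) / (r - 0)) / ((\<psi> r - \<psi> 0) / (r - 0))) \<longlongrightarrow> g x \<bullet> (c *\<^sub>R g x) / (g x \<bullet> g x)) (at_right 0)"
    by (intro tendsto_divide 1 2) (use nz in simp)
  then have 3: "((\<lambda>r. ((\<xi> r - \<xi> 0) / (r - 0)) / ((\<psi> r - \<psi> 0) / (r - 0))) \<longlongrightarrow> c) (at_right 0)"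
    using nz by simp
  obtain d where "d > 0" and d: "\<And>r. 0 < r \<Longrightarrow> r < d \<Longrightarrow> \<psi> r > \<psi> 0"
    using gderiv_ascent[OF w nz] unfolding \<psi>_def by auto
  have psi0: "\<psi> 0 = w x" "\<xi> 0 = h x" by (simp_all add: \<psi>_def \<xi>_def)
  show ?thesis
  proof (rule tendstoI)
    fix e :: real assume "e > 0"
    obtain \<rho> where "\<rho> > 0" and \<rho>: "\<And>r. 0 < r \<Longrightarrow> r < \<rho> \<Longrightarrow>
        dist (((\<xi> r - \<xi> 0) / (r - 0)) / ((\<psi> r - \<psi> 0) / (r - 0))) c < e"
      using tendstoD[OF 3 \<open>e > 0\<close>] unfolding eventually_at_right_field by auto
    define m where "m = min d \<rho> / 2"
    have m: "0 < m" "m < d" "m < \<rho>" using \<open>d > 0\<close> \<open>\<rho> > 0\<close> by (auto simp: m_def)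
    have "dist ((H t - H (w x)) / (t - w x)) c < e" if t: "w x < t" "t < min b (\<psi> m)" for t
    proof -
      \<comment> \<open>\<open>\<psi>\<close> may oscillate; some preimage \<open>r\<close> of
        \<open>t\<close> below \<open>\<rho>\<close> is all that the estimate asks for.\<close>
      obtain r where r: "0 \<le> r" "r \<le> m" "\<psi> r = t"
        using IVT'[of \<psi> 0 t m] t m psi0 cont by auto
      have "r \<noteq> 0" using r t psi0 by auto
      then have r': "0 < r" "r < \<rho>" using r m by auto
      have "\<xi> r = H t" using H(1)[of "x + r *\<^sub>R g x"] r t by (simp add: \<psi>_def \<xi>_def)
      then show ?thesis
        using \<rho>[OF r'] r' r(3) psi0 H(2) by simp
    qed
    moreover have "w x < min b (\<psi> m)" using H(3) d[of m] m psi0 by simp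
    ultimately show "\<forall>\<^sub>F t in at_right (w x). dist ((H t - H (w x)) / (t - w x)) c < e"
      unfolding eventually_at_right_field by blast
  qed
qed

section \<open>Sard's theorem in the plane\<close>

text \<open>A cube of side s inside the ball of its tag is mapped into an interval of length at most
  a constant times epsilon s^n, that is, epsilon times its volume. Summing over the non-overlapping
  cubes gives epsilon times the volume of \<open>Q\<close>. Flatness is asked only between points of
  \<open>S\<close>, so \<open>k\<close> may be an inverse defined on an irregular set.\<close>

lemma negligible_flat_image:
  fixes k :: "'a::euclidean_space \<Rightarrow> real"
  assumes "bounded S"
    and flat: "\<And>x e. x \<in> S \<Longrightarrow> e > 0 \<Longrightarrow>
      \<exists>d>0. \<forall>y\<in>S. norm (y - x) < d \<longrightarrow> \<bar>k y - k x\<bar> \<le> e * norm (y - x) ^ DIM('a)"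
  shows "negligible (k ` S)"
  unfolding negligible_outer_le
proof (intro allI impI)
  fix e :: real
  assume "e > 0"
  \<comment> \<open>The n-th power of the constant in: two points of a cube of side s in dimension n
    are at distance at most n s.\<close>
  let ?D = "real DIM('a) ^ DIM('a)"
  obtain c where "c > 0" and c: "\<And>x. x \<in> S \<Longrightarrow> norm x \<le> c"
    using \<open>bounded S\<close> bounded_pos by blast
  define Q :: "'a set" where "Q = cbox (- (c *\<^sub>R One)) (c *\<^sub>R One)"
  have "\<bar>x \<bullet> i\<bar> \<le> c" if "x \<in> S" "i \<in> Basis" for x i
    using Basis_le_norm[OF that(2), of x] c[OF that(1)] by linarith
  then have SQ: "S \<subseteq> Q"
    by (auto simp: Q_def mem_box abs_le_iff minus_le_iff)
  have ne: "box (- (c *\<^sub>R One)) (c *\<^sub>R One :: 'a) \<noteq> {}"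
    using \<open>c > 0\<close> by (simp add: box_ne_empty)
  have Q0: "measure lborel Q > 0"
    using ne by (simp add: Q_def content_pos_lt_eq box_ne_empty)
  \<comment> \<open>The 2 is there because \<open>I K\<close> below extends to both sides of
    \<open>k (z K)\<close>.\<close>
  define \<epsilon> where "\<epsilon> = e / (2 * ?D * measure lborel Q)"
  have "\<epsilon> > 0"
    using \<open>e > 0\<close> Q0 by (simp add: \<epsilon>_def)
  have "\<forall>x. \<exists>d>0. x \<in> S \<longrightarrow>
      (\<forall>y\<in>S. norm (y - x) < d \<longrightarrow> \<bar>k y - k x\<bar> \<le> \<epsilon> * norm (y - x) ^ DIM('a))"
    using flat \<open>\<epsilon> > 0\<close> by (metis zero_less_one)
  then obtain d where d0: "\<And>x. d x > 0" and d: "\<And>x y. x \<in> S \<Longrightarrow> y \<in> S \<Longrightarrow> norm (y - x) < d x \<Longrightarrow>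
      \<bar>k y - k x\<bar> \<le> \<epsilon> * norm (y - x) ^ DIM('a)"
    by metis
  have gauge: "gauge (\<lambda>x. ball x (d x))"
    using d0 by (auto simp: gauge_def)
  obtain \<D> where D: "countable \<D>" "\<Union>\<D> \<subseteq> Q"
    and Dbox: "\<And>K. K \<in> \<D> \<Longrightarrow> interior K \<noteq> {} \<and> (\<exists>c d. K = cbox c d)"
    and Dpw: "pairwise (\<lambda>A B. interior A \<inter> interior B = {}) \<D>"
    and Dz: "\<And>K. K \<in> \<D> \<Longrightarrow> \<exists>x \<in> S \<inter> K. K \<subseteq> ball x (d x)"
    and Dside: "\<And>u v. cbox u v \<in> \<D> \<Longrightarrow>
      \<exists>n. \<forall>i \<in> Basis. v \<bullet> i - u \<bullet> i = ((c *\<^sub>R One) \<bullet> i - (- (c *\<^sub>R One :: 'a)) \<bullet> i) / 2^n"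
    and SD: "S \<subseteq> \<Union>\<D>"
  proof (rule covering_lemma[OF SQ[unfolded Q_def] ne gauge], goal_cases)
    case (1 \<D>)
    show thesis by (rule 1(1)[OF 1(2) 1(3)[folded Q_def] 1(4-8)])
  qed
  obtain z where z: "\<And>K. K \<in> \<D> \<Longrightarrow> z K \<in> S \<and> z K \<in> K \<and> K \<subseteq> ball (z K) (d (z K))"
    using Dz by (metis Int_iff)
  have cont: "norm (y - x) ^ DIM('a) \<le> ?D * measure lborel K" if "K \<in> \<D>" "x \<in> K" "y \<in> K" for K x y
  proof -
    obtain u v where K: "K = cbox u v" using Dbox[OF \<open>K \<in> \<D>\<close>] by blast
    have "\<exists>n. \<forall>i \<in> Basis. v \<bullet> i - u \<bullet> i = 2 * c / 2^n"
      using Dside[of u v] \<open>K \<in> \<D>\<close> by (simp add: K)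
    then obtain n where n: "\<And>i. i \<in> Basis \<Longrightarrow> v \<bullet> i - u \<bullet> i = 2 * c / 2^n"
      by blast
    define s where "s = 2 * c / 2^n"
    have s: "s \<ge> 0" using \<open>c > 0\<close> by (simp add: s_def)
    have uv: "\<And>i. i \<in> Basis \<Longrightarrow> u \<bullet> i \<le> v \<bullet> i" using n s unfolding s_def[symmetric] by fastforce
    have "measure lborel K = s ^ DIM('a)"
      using uv n by (simp add: K content_cbox s_def inner_diff_left)
    moreover have "norm (y - x) \<le> real DIM('a) * s"
    proof -
      have "norm (y - x) \<le> (\<Sum>i\<in>Basis. \<bar>(y - x) \<bullet> i\<bar>)" by (rule norm_le_l1)
      also have "\<dots> \<le> real DIM('a) * s"
      proof (rule sum_bounded_above)
        fix i :: 'a assume i: "i \<in> Basis"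
        show "\<bar>(y - x) \<bullet> i\<bar> \<le> s"
          using that(2,3) n[OF i] i unfolding s_def K
          by (smt (verit) inner_diff_left mem_box(2))
      qed
      finally show ?thesis .
    qed
    ultimately show ?thesis
      by (metis norm_ge_zero power_mono power_mult_distrib)
  qed
  define I where "I K = cbox (k (z K) - \<epsilon> * (?D * measure lborel K)) (k (z K) + \<epsilon> * (?D * measure lborel K))" for K
  have mI: "measure lebesgue (I K) = 2 * \<epsilon> * ?D * measure lborel K" for K
    using \<open>\<epsilon> > 0\<close> by (simp add: I_def)
  have lI: "I K \<in> lmeasurable" for K by (simp add: I_def)
  have fin: "measure lebesgue (\<Union>K\<in>\<D>'. I K) \<le> e" if "\<D>' \<subseteq> \<D>" "finite \<D>'" for \<D>'
  proof -
    have "{} \<notin> \<D>'" using Dbox that by fastforce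
    moreover have "\<And>K. K \<in> \<D>' \<Longrightarrow> \<exists>a b. K = cbox a b" using Dbox that by blast
    ultimately have div: "\<D>' division_of \<Union>\<D>'"
      using pairwise_subset [OF Dpw \<open>\<D>' \<subseteq> \<D>\<close>] unfolding pairwise_def division_of_def
      using \<open>finite \<D>'\<close> by force
    have "measure lebesgue (\<Union>K\<in>\<D>'. I K) \<le> (\<Sum>K\<in>\<D>'. measure lebesgue (I K))"
      by (rule measure_UNION_le) (use \<open>finite \<D>'\<close> lI in auto)
    also have "\<dots> = 2 * \<epsilon> * ?D * sum (measure lborel) \<D>'"
      by (simp only: mI sum_distrib_left)
    also have "\<dots> \<le> 2 * \<epsilon> * ?D * measure lborel Q"
    proof (rule mult_left_mono)
      show "sum (measure lborel) \<D>' \<le> measure lborel Q"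
        unfolding Q_def by (rule subadditive_content_division[OF div]) (use D(2) that in \<open>auto simp: Q_def\<close>)
    qed (use \<open>\<epsilon> > 0\<close> in simp)
    also have "\<dots> = e" using Q0 by (simp add: \<epsilon>_def)
    finally show ?thesis .
  qed
  show "\<exists>T. k ` S \<subseteq> T \<and> T \<in> lmeasurable \<and> measure lebesgue T \<le> e"
  proof (intro exI conjI)
    show "k ` S \<subseteq> (\<Union>K\<in>\<D>. I K)"
    proof clarify
      fix y assume y: "y \<in> S"
      then obtain K where K: "K \<in> \<D>" "y \<in> K" using SD by auto
      have "norm (y - z K) < d (z K)"
        using z[OF K(1)] K(2) by (metis dist_commute dist_norm mem_ball subsetD)
      then have "\<bar>k y - k (z K)\<bar> \<le> \<epsilon> * norm (y - z K) ^ DIM('a)"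
        using d y z K by blast
      also have "\<dots> \<le> \<epsilon> * (?D * measure lborel K)"
        using cont[OF K(1), of "z K" y] z[OF K(1)] K(2) \<open>\<epsilon> > 0\<close> by (intro mult_left_mono) auto
      finally show "k y \<in> (\<Union>K\<in>\<D>. I K)"
        using K(1) unfolding I_def by (intro UN_I[of K]) auto
    qed
    show "(\<Union>K\<in>\<D>. I K) \<in> lmeasurable"
      by (rule fmeasurable_UN_bound[OF D(1) lI fin]) auto
    show "measure lebesgue (\<Union>K\<in>\<D>. I K) \<le> e"
      by (rule measure_UN_bound[OF D(1) lI fin]) auto
  qed
qed

text \<open>Vector-valued counterpart of \<open>gderiv_strict\<close>. The finitely many partial
  derivatives are controlled at once, each to within \<open>e / CARD('n)\<close>, so that their sum
  stays within \<open>e\<close>.\<close>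

lemma C1_strict_derivative:
  fixes f :: "real^'n \<Rightarrow> 'b::real_normed_vector"
  assumes "C1 f" "e > 0"
  obtains d where "d > 0" "\<And>y z. y \<in> ball x d \<Longrightarrow> z \<in> ball x d \<Longrightarrow>
    norm (f y - f z - frechet_derivative f (at x) (y - z)) \<le> e * norm (y - z)"
proof -
  define D where "D y h = (\<Sum>i\<in>UNIV. h $ i *\<^sub>R partial_deriv i f y)" for y h
  have der: "(f has_derivative D y) (at y)" for y
    using C1_has_derivative[OF assms(1)] unfolding D_def[abs_def] .
  define e' where "e' = e / real CARD('n)"
  have "e' > 0" using assms(2) by (simp add: e'_def)
  have "\<forall>\<^sub>F y in nhds x. \<forall>i. dist (partial_deriv i f y) (partial_deriv i f x) < e'"
  proof (rule eventually_all_finite)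
    fix i
    have "isCont (partial_deriv i f) x"
      using assms(1) continuous_on_eq_continuous_at unfolding C1_def by blast
    then show "\<forall>\<^sub>F y in nhds x. dist (partial_deriv i f y) (partial_deriv i f x) < e'"
      using \<open>e' > 0\<close> unfolding continuous_at_eps_delta eventually_nhds_metric by blast
  qed
  then obtain d where "d > 0"
    and d: "\<And>y i. dist y x < d \<Longrightarrow> dist (partial_deriv i f y) (partial_deriv i f x) < e'"
    unfolding eventually_nhds_metric by blast
  show ?thesis
  proof
    show "d > 0" by fact
    fix y z assume yz: "y \<in> ball x d" "z \<in> ball x d"
    have on: "onorm (\<lambda>h. D w h - D x h) \<le> e" if "w \<in> ball x d" for w
    proof (rule onorm_le)
      fix h
      have "norm (D w h - D x h) = norm (\<Sum>i\<in>UNIV. h $ i *\<^sub>R (partial_deriv i f w - partial_deriv i f x))"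
        by (simp add: D_def sum_subtractf scaleR_diff_right)
      also have "\<dots> \<le> (\<Sum>i\<in>(UNIV::'n set). norm h * e')"
      proof (rule sum_norm_le)
        fix i
        show "norm (h $ i *\<^sub>R (partial_deriv i f w - partial_deriv i f x)) \<le> norm h * e'"
          using d[of w i] that component_le_norm_cart[of h i]
          by (auto simp: dist_norm norm_minus_commute intro!: mult_mono)
      qed
      also have "\<dots> = e * norm h" by (simp add: e'_def)
      finally show "norm (D w h - D x h) \<le> e * norm h" .
    qed
    have "norm (f y - f z - D x (y - z)) \<le> norm (y - z) * e"
    proof (rule differentiable_bound_linearization[where S="ball x d" and f=f and f'=D])
      fix t :: real assume "t \<in> {0..1}"
      then have "z + t *\<^sub>R (y - z) \<in> closed_segment z y"
        by (auto simp: closed_segment_def algebra_simps intro!: exI[of _ t])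
      then show "z + t *\<^sub>R (y - z) \<in> ball x d"
        using yz by (meson convex_ball closed_segment_subset subsetD)
    next
      fix w assume "w \<in> ball x d"
      then show "onorm (D w - D x) \<le> e" using on by (simp add: fun_diff_def)
    qed (use der \<open>d > 0\<close> in \<open>auto intro: has_derivative_at_withinI\<close>)
    then show "norm (f y - f z - frechet_derivative f (at x) (y - z)) \<le> e * norm (y - z)"
      by (simp add: frechet_derivative_at[OF der, symmetric] mult.commute)
  qed
qed

text \<open>Mean value inequality on the segment. Used with small \<open>c\<close> where the Hessian
  vanishes, and with a fixed \<open>c\<close> at other critical points.\<close>

lemma gderiv_quadratic_bound:
  fixes u :: "'a::euclidean_space \<Rightarrow> real"
  assumes "\<And>z. GDERIV u z :> g z"
    and "\<And>z. norm (z - x) \<le> norm (y - x) \<Longrightarrow> norm (g z) \<le> c * norm (z - x)" and "c \<ge> 0"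
  shows "\<bar>u y - u x\<bar> \<le> c * norm (y - x) ^ 2"
proof -
  have "norm (u y - u x) \<le> (c * norm (y - x)) * norm (y - x)"
  proof (rule differentiable_bound[where S="closed_segment x y" and f'="\<lambda>z h. h \<bullet> g z"])
    fix z assume z: "z \<in> closed_segment x y"
    show "(u has_derivative (\<lambda>h. h \<bullet> g z)) (at z within closed_segment x y)"
      using assms(1) has_derivative_at_withinI unfolding gderiv_def by blast
    have zx: "norm (z - x) \<le> norm (y - x)"
      using segment_bound1[OF z] by (simp add: norm_minus_commute)
    have gz: "norm (g z) \<le> c * norm (y - x)"
      using assms(2)[OF zx] mult_left_mono[OF zx \<open>c \<ge> 0\<close>] by simp
    show "onorm (\<lambda>h. h \<bullet> g z) \<le> c * norm (y - x)"
    proof (rule onorm_le)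
      fix h
      show "norm (h \<bullet> g z) \<le> c * norm (y - x) * norm h"
        using Cauchy_Schwarz_ineq2[of h "g z"] mult_left_mono[OF gz norm_ge_zero[of h]]
        by (simp add: mult.commute)
    qed
  qed auto
  then show ?thesis by (simp add: power2_eq_square mult.assoc)
qed

text \<open>On the part of the critical set where the Hessian is nonzero, some linear functional has a
  Lipschitz inverse, so the quadratic flatness of \<open>u\<close> at critical points becomes superlinear
  flatness in one variable; where the Hessian vanishes, \<open>u\<close> is \<open>o(r\<^sup>2)\<close>-flat in the plane.\<close>

lemma negligible_critical_values:
  fixes u :: "real^2 \<Rightarrow> real"
  assumes u: "\<And>x. GDERIV u x :> g x" and g: "C1 g"
  shows "negligible (u ` {x. g x = 0})"
proof -
  define D where "D y = frechet_derivative g (at y)" for y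
  have der: "(g has_derivative D y) (at y)" for y
    using g frechet_derivative_works unfolding C1_def D_def by blast
  have lin: "linear (D y)" for y using der has_derivative_linear by blast
  have small: "\<exists>d>0. \<forall>z. norm (z - x) < d \<longrightarrow> norm (g z - D x (z - x)) \<le> e * norm (z - x)"
    if "g x = 0" "e > 0" for x e
    using der[of x] that unfolding has_derivative_at_alt by force
  \<comment> \<open>Cut into bounded pieces for the covering argument; here the required exponent
    \<open>DIM(real^2)\<close> is 2, matching the quadratic bound.\<close>
  define Z where "Z n = {x. g x = 0 \<and> D x = (\<lambda>_. 0) \<and> norm x \<le> real n}" for n
  have Z: "negligible (u ` Z n)" for n
  proof (rule negligible_flat_image)
    show "bounded (Z n)" unfolding Z_def bounded_iff by blast
    fix x e assume x: "x \<in> Z n" and "(e::real) > 0"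
    then obtain d where "d > 0" and d: "\<And>z. norm (z - x) < d \<Longrightarrow> norm (g z) \<le> e * norm (z - x)"
      using small[of x e] unfolding Z_def by auto
    show "\<exists>d>0. \<forall>y\<in>Z n. norm (y - x) < d \<longrightarrow> \<bar>u y - u x\<bar> \<le> e * norm (y - x) ^ DIM(real^2)"
      using \<open>d > 0\<close> gderiv_quadratic_bound[OF u, of x _ e] d \<open>e > 0\<close>
      by (intro exI[of _ d]) force
  qed
  define N where "N = {x. g x = 0 \<and> D x \<noteq> (\<lambda>_. 0)}"
  have loc: "\<exists>B. open B \<and> x0 \<in> B \<and> negligible (u ` (N \<inter> B))" if x0: "x0 \<in> N" for x0
  proof -
    obtain h i where hi: "D x0 h $ i \<noteq> 0"
      using x0 unfolding N_def by (auto simp: fun_eq_iff vec_eq_iff)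
    have l: "linear (\<lambda>h. D x0 h $ i)"
      using lin[of x0] by (auto simp: linear_iff)
    \<comment> \<open>A nonzero row of the Hessian at \<open>x0\<close>. Since \<open>g\<close>
      vanishes at both of two nearby critical points, their difference is nearly orthogonal to
      \<open>a\<close>.\<close>
    define a where "a = adjoint (\<lambda>h. D x0 h $ i) 1"
    have a: "D x0 h $ i = a \<bullet> h" for h
      using adjoint_works[OF l, of h 1] by (simp add: a_def inner_commute)
    have "norm a > 0" using hi a by auto
    then obtain d where "d > 0" and d: "\<And>y z. y \<in> ball x0 d \<Longrightarrow> z \<in> ball x0 d \<Longrightarrow>
        norm (g y - g z - D x0 (y - z)) \<le> (norm a / 2) * norm (y - z)"
      using C1_strict_derivative[OF g, of "norm a / 2" x0] unfolding D_def by auto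
    \<comment> \<open>The coordinate orthogonal to \<open>a\<close>. As |a . (y - x)| is at most
      half of |a| |y - x| on \<open>T\<close>, Pythagoras leaves at least half of it for
      \<open>perp a\<close>; the factor 2 makes \<open>\<pi>\<close> non-contracting on
      \<open>T\<close>.\<close>
    define \<pi> where "\<pi> x = (2 / norm a) * (perp a \<bullet> x)" for x
    define T where "T = N \<inter> ball x0 d"
    have lips: "norm (y - x) \<le> \<bar>\<pi> y - \<pi> x\<bar>" if "x \<in> T" "y \<in> T" for x y
    proof -
      have "norm (D x0 (y - x)) \<le> (norm a / 2) * norm (y - x)"
        using d[of y x] that by (auto simp: T_def N_def)
      then have "\<bar>a \<bullet> (y - x)\<bar> \<le> norm a / 2 * norm (y - x)"
        using component_le_norm_cart[of "D x0 (y - x)" i] a by simp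
      then have "(a \<bullet> (y - x))\<^sup>2 \<le> (norm a / 2 * norm (y - x))\<^sup>2"
        using \<open>norm a > 0\<close> by (simp add: abs_le_square_iff[symmetric] abs_mult)
      moreover have "(norm a)\<^sup>2 * (norm (y - x))\<^sup>2 = (a \<bullet> (y - x))\<^sup>2 + (perp a \<bullet> (y - x))\<^sup>2"
        unfolding power2_norm_eq_inner perp_def inner_vec_def by (simp add: sum_2 power2_eq_square algebra_simps)
      moreover have "(norm a / 2 * norm (y - x))\<^sup>2 = (norm a)\<^sup>2 * (norm (y - x))\<^sup>2 / 4"
        by (simp add: power_mult_distrib power_divide)
      moreover have "(norm a)\<^sup>2 * (norm (y - x))\<^sup>2 \<ge> 0" by simp
      ultimately have "(norm a)\<^sup>2 * (norm (y - x))\<^sup>2 \<le> 4 * (perp a \<bullet> (y - x))\<^sup>2"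
        by linarith
      then have "(norm a * norm (y - x))\<^sup>2 \<le> \<bar>2 * (perp a \<bullet> (y - x))\<bar>\<^sup>2"
        by (simp add: power_mult_distrib)
      then have "norm a * norm (y - x) \<le> \<bar>2 * (perp a \<bullet> (y - x))\<bar>"
        by (rule power2_le_imp_le) simp
      moreover have "norm a * \<bar>\<pi> y - \<pi> x\<bar> = \<bar>norm a * (\<pi> y - \<pi> x)\<bar>" by (simp only: abs_mult abs_norm_cancel)
      moreover have "norm a * (\<pi> y - \<pi> x) = 2 * (perp a \<bullet> (y - x))"
        using \<open>norm a > 0\<close> by (simp add: \<pi>_def inner_diff_right right_diff_distrib)
      ultimately have "norm a * norm (y - x) \<le> norm a * \<bar>\<pi> y - \<pi> x\<bar>" by presburger
      then show ?thesis using \<open>norm a > 0\<close> by (simp only: mult_le_cancel_left_pos)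
    qed
    have inj: "inj_on \<pi> T"
      using lips by (force simp: inj_on_def)
    \<comment> \<open>\<open>u\<close> read as a function of one variable: the required exponent
      drops to 1, and a quadratic bound with any fixed constant is superlinear.\<close>
    define k where "k = u \<circ> inv_into T \<pi>"
    have k: "k (\<pi> x) = u x" if "x \<in> T" for x
      using inj that by (simp add: k_def inv_into_f_f)
    have "negligible (k ` \<pi> ` T)"
    proof (rule negligible_flat_image)
      have "bounded_linear \<pi>"
        unfolding \<pi>_def by (intro bounded_linear_const_mult bounded_linear_inner_right)
      then show "bounded (\<pi> ` T)"
        by (intro bounded_linear_image) (auto simp: T_def)
      fix s e assume "s \<in> \<pi> ` T" and "(e::real) > 0"
      then obtain x where x: "x \<in> T" "s = \<pi> x" by blast
      obtain c where c: "c > 0" "\<And>h. norm (D x h) \<le> c * norm h"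
        using linear_bounded_pos[OF lin[of x]] by blast
      obtain r where "r > 0" and r: "\<And>z. norm (z - x) < r \<Longrightarrow> norm (g z - D x (z - x)) \<le> 1 * norm (z - x)"
        using small[of x 1] x by (auto simp: T_def N_def)
      have gz: "norm (g z) \<le> (c + 1) * norm (z - x)" if "norm (z - x) < r" for z
        using r[OF that] c(2)[of "z - x"] norm_triangle_ineq2[of "g z" "D x (z - x)"]
        by (simp add: algebra_simps)
      have "\<bar>u y - u x\<bar> \<le> e * norm (\<pi> y - \<pi> x)"
        if y: "y \<in> T" and n: "norm (\<pi> y - \<pi> x) < min r (e / (c + 1))" for y
      proof -
        have yx: "norm (y - x) \<le> norm (\<pi> y - \<pi> x)" using lips[OF x(1) y] by simp
        have "\<bar>u y - u x\<bar> \<le> (c + 1) * norm (y - x) ^ 2"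
          by (rule gderiv_quadratic_bound[OF u]) (use gz yx n c in auto)
        also have "\<dots> \<le> (c + 1) * norm (\<pi> y - \<pi> x) ^ 2"
          using yx c by (intro mult_left_mono power_mono) auto
        also have "\<dots> = ((c + 1) * norm (\<pi> y - \<pi> x)) * norm (\<pi> y - \<pi> x)"
          by (simp add: power2_eq_square)
        also have "\<dots> \<le> e * norm (\<pi> y - \<pi> x)"
          using n c by (intro mult_right_mono) (auto simp: field_simps)
        finally show ?thesis .
      qed
      then show "\<exists>d>0. \<forall>t\<in>\<pi> ` T. norm (t - s) < d \<longrightarrow> \<bar>k t - k s\<bar> \<le> e * norm (t - s) ^ DIM(real)"
        using \<open>r > 0\<close> \<open>e > 0\<close> c x k by (intro exI[of _ "min r (e / (c + 1))"]) auto
    qed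
    moreover have "k ` \<pi> ` T = u ` T" using k by (force simp: image_image)
    ultimately show ?thesis
      using \<open>d > 0\<close> by (intro exI[of _ "ball x0 d"]) (simp add: T_def)
  qed
  then obtain B where B: "\<And>x. x \<in> N \<Longrightarrow> open (B x) \<and> x \<in> B x \<and> negligible (u ` (N \<inter> B x))"
    by metis
  obtain F where F: "F \<subseteq> B ` N" "countable F" "\<Union>F = \<Union>(B ` N)"
    using Lindelof[of "B ` N"] B by blast
  have "negligible (\<Union>C\<in>F. u ` (N \<inter> C))"
    using F B by (intro negligible_countable_Union) auto
  moreover have "negligible (\<Union>n. u ` Z n)"
    using Z by (intro negligible_countable_Union) auto
  moreover have "u ` {x. g x = 0} \<subseteq> (\<Union>C\<in>F. u ` (N \<inter> C)) \<union> (\<Union>n. u ` Z n)"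
  proof clarify
    fix x assume x: "g x = 0" "u x \<notin> (\<Union>n. u ` Z n)"
    have "x \<in> N"
      using x real_arch_simple[of "norm x"] unfolding N_def Z_def by blast
    then have "x \<in> \<Union>F" using F(3) B by blast
    then show "u x \<in> (\<Union>C\<in>F. u ` (N \<inter> C))" using \<open>x \<in> N\<close> by blast
  qed
  ultimately show ?thesis
    using negligible_Un negligible_subset by blast
qed

section \<open>Fields of finite energy\<close>

definition pt :: "real \<Rightarrow> real \<Rightarrow> real^2"
  where "pt a b = a *\<^sub>R axis 1 1 + b *\<^sub>R axis 2 1"

lemma pt_nth [simp]: "pt a b $ 1 = a" "pt a b $ 2 = b"
  by (simp_all add: pt_def axis_def)

lemma pt_eta [simp]: "pt (x $ 1) (x $ 2) = x"
  by (simp add: vec_eq_iff forall_2)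

lemma continuous_on_pt [continuous_intros]:
  "continuous_on A f \<Longrightarrow> continuous_on A g \<Longrightarrow> continuous_on A (\<lambda>x. pt (f x) (g x))"
  unfolding pt_def by (intro continuous_intros)

lemma Basis_real2: "(Basis :: (real^2) set) = {axis 1 1, axis 2 1}"
  unfolding Basis_vec_def by (auto simp: exhaust_2) (metis exhaust_2)

text \<open>Both measures agree on boxes, which determines them. This carries Tonelli from pairs
  over to \<open>real^2\<close>.\<close>

lemma lborel_real2: "lborel = distr (lborel :: (real \<times> real) measure) borel (\<lambda>z. pt (fst z) (snd z))"
proof (rule lborel_eqI)
  have [measurable]: "(\<lambda>z. pt (fst z) (snd z)) \<in> borel_measurable borel"
    by (intro borel_measurable_continuous_onI continuous_intros)
  fix l u :: "real^2" assume "\<And>b. b \<in> Basis \<Longrightarrow> l \<bullet> b \<le> u \<bullet> b"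
  then have le: "l $ 1 \<le> u $ 1" "l $ 2 \<le> u $ 2"
    by (simp_all add: Basis_real2 cart_eq_inner_axis)
  have "(\<lambda>z. pt (fst z) (snd z)) -` box l u = box (l $ 1, l $ 2) (u $ 1, u $ 2)"
    by (auto simp: mem_box Basis_real2 Basis_prod_def simp flip: cart_eq_inner_axis)
  then have "emeasure (distr lborel borel (\<lambda>z. pt (fst z) (snd z))) (box l u) =
      emeasure lborel (box (l $ 1, l $ 2) (u $ 1, u $ 2))"
    by (simp add: emeasure_distr)
  also have "\<dots> = (\<Prod>b\<in>Basis. (u - l) \<bullet> b)"
    using le by (simp add: emeasure_lborel_box_eq Basis_real2 Basis_prod_def axis_eq_axis
        inner_diff_left flip: cart_eq_inner_axis)
  finally show "emeasure (distr lborel borel (\<lambda>z. pt (fst z) (snd z))) (box l u) = (\<Prod>b\<in>Basis. (u - l) \<bullet> b)" .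
qed simp

lemma nn_integral_real2:
  fixes f :: "real^2 \<Rightarrow> ennreal"
  assumes [measurable]: "f \<in> borel_measurable borel"
  shows "(\<integral>\<^sup>+a. \<integral>\<^sup>+b. f (pt a b) \<partial>lborel \<partial>lborel) = (\<integral>\<^sup>+x. f x \<partial>lborel)"
    and "(\<integral>\<^sup>+b. \<integral>\<^sup>+a. f (pt a b) \<partial>lborel \<partial>lborel) = (\<integral>\<^sup>+x. f x \<partial>lborel)"
    and "(\<lambda>a. \<integral>\<^sup>+b. f (pt a b) \<partial>lborel) \<in> borel_measurable borel"
    and "(\<lambda>b. \<integral>\<^sup>+a. f (pt a b) \<partial>lborel) \<in> borel_measurable borel"
proof -
  have [measurable]: "(\<lambda>z. pt (fst z) (snd z)) \<in> borel_measurable borel"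
    by (intro borel_measurable_continuous_onI continuous_intros)
  define F where "F z = f (pt (fst z) (snd z))" for z
  have F[measurable]: "F \<in> borel_measurable (lborel \<Otimes>\<^sub>M lborel)"
    unfolding F_def lborel_prod by measurable
  have I: "(\<integral>\<^sup>+x. f x \<partial>lborel) = (\<integral>\<^sup>+z. F z \<partial>(lborel \<Otimes>\<^sub>M lborel))"
    unfolding lborel_prod F_def by (subst lborel_real2) (simp add: nn_integral_distr)
  show "(\<integral>\<^sup>+a. \<integral>\<^sup>+b. f (pt a b) \<partial>lborel \<partial>lborel) = (\<integral>\<^sup>+x. f x \<partial>lborel)"
    unfolding I using lborel.nn_integral_fst[OF F] by (simp add: F_def)
  show "(\<integral>\<^sup>+b. \<integral>\<^sup>+a. f (pt a b) \<partial>lborel \<partial>lborel) = (\<integral>\<^sup>+x. f x \<partial>lborel)"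
    unfolding I using lborel_pair.nn_integral_snd[OF F] by (simp add: F_def)
  show "(\<lambda>a. \<integral>\<^sup>+b. f (pt a b) \<partial>lborel) \<in> borel_measurable borel"
    using lborel.borel_measurable_nn_integral_fst[OF F] by (simp add: F_def)
  have "(\<lambda>(b, a). F (a, b)) \<in> borel_measurable (lborel \<Otimes>\<^sub>M lborel)"
    by measurable
  then show "(\<lambda>b. \<integral>\<^sup>+a. f (pt a b) \<partial>lborel) \<in> borel_measurable borel"
    using lborel.borel_measurable_nn_integral_fst by (fastforce simp: F_def)
qed

text \<open>Otherwise \<open>A r\<close> would be at least \<open>\<delta> / r\<close> for all large
  \<open>r\<close>, and the integral of \<open>\<delta> / r\<close> diverges
  logarithmically.\<close>

lemma exists_small_scale:
  fixes A :: "real \<Rightarrow> ennreal"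
  assumes "(\<integral>\<^sup>+r. A r \<partial>lborel) < \<infinity>" and "\<delta> > 0"
  obtains r where "r > R" "r > 0" "ennreal r * A r < ennreal \<delta>"
proof (rule ccontr)
  assume "\<not> thesis"
  then have neg: "ennreal \<delta> \<le> ennreal r * A r" if "r > R" "r > 0" for r
    using that \<open>\<And>r. R < r \<Longrightarrow> 0 < r \<Longrightarrow> ennreal r * A r < ennreal \<delta> \<Longrightarrow> thesis\<close> by force
  define a where "a = max R 0 + 1"
  have a: "a > R" "a > 0" by (auto simp: a_def)
  have low: "ennreal (\<delta> / r) \<le> A r" if "r \<ge> a" for r
  proof (cases "A r")
    case (real c)
    have "r > R" "r > 0" using that a by auto
    then have "\<delta> \<le> r * c"
      using neg[of r] real by (simp add: ennreal_mult[symmetric])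
    then show ?thesis using real \<open>r > 0\<close> by (simp add: field_simps)
  qed simp
  obtain C where C: "(\<integral>\<^sup>+r. A r \<partial>lborel) = ennreal C" "C \<ge> 0"
    using assms(1) by (cases "\<integral>\<^sup>+r. A r \<partial>lborel") auto
  \<comment> \<open>Chosen so that \<open>\<delta> / r\<close> has integral \<open>C + 1\<close>
    over [a, b], more than \<open>A\<close> has in total.\<close>
  define b where "b = a * exp ((C + 1) / \<delta>)"
  have ab: "a \<le> b" using a C(2) \<open>\<delta> > 0\<close> by (simp add: b_def)
  have "(\<integral>\<^sup>+r. ennreal (\<delta> / r) * indicator {a..b} r \<partial>lborel) = ennreal (\<delta> * ln b - \<delta> * ln a)"
  proof (rule nn_integral_FTC_Icc)
    show "(\<lambda>r. \<delta> / r) \<in> borel_measurable borel" by measurable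
    fix r assume "r \<in> {a..b}"
    then have "r > 0" using a by simp
    then show "((\<lambda>r. \<delta> * ln r) has_real_derivative \<delta> / r) (at r)" "0 \<le> \<delta> / r"
      using \<open>\<delta> > 0\<close> by (auto intro!: derivative_eq_intros)
  qed (use ab in auto)
  moreover have "(\<integral>\<^sup>+r. ennreal (\<delta> / r) * indicator {a..b} r \<partial>lborel) \<le> (\<integral>\<^sup>+r. A r \<partial>lborel)"
    by (intro nn_integral_mono) (use low in \<open>auto simp: indicator_def\<close>)
  moreover have "\<delta> * ln b - \<delta> * ln a = C + 1"
    using a \<open>\<delta> > 0\<close> by (simp add: b_def ln_mult distrib_left add_divide_distrib)
  ultimately show False using C by simp
qed

text \<open>Cauchy-Schwarz in pointwise form: \<open>\<bar>\<psi>' x\<bar>\<close> is at most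
  \<open>\<eta> / r\<close> plus \<open>r / \<eta>\<close> times its square. Over a length of at
  most 2r the first term contributes \<open>2 * \<eta>\<close> and the second at most
  \<open>\<eta>\<close>.\<close>

lemma oscillation_le:
  fixes \<psi> :: "real \<Rightarrow> real"
  assumes der: "\<And>x. (\<psi> has_real_derivative \<psi>' x) (at x)"
    and q: "continuous_on UNIV q" "\<And>x. (\<psi>' x)\<^sup>2 \<le> q x"
    and small: "ennreal r * (\<integral>\<^sup>+x. ennreal (q x) \<partial>lborel) < ennreal (\<eta>\<^sup>2)" and "r > 0" "\<eta> > 0"
    and ab: "a \<in> {-r..r}" "b \<in> {-r..r}"
  shows "\<bar>\<psi> b - \<psi> a\<bar> \<le> 3 * \<eta>"
proof -
  have main: "\<bar>\<psi> b - \<psi> a\<bar> \<le> 3 * \<eta>" if ab: "a \<in> {-r..r}" "b \<in> {-r..r}" "a \<le> b" for a b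
  proof -
    have q0: "0 \<le> q x" for x using q(2)[of x] by (meson order_trans zero_le_power2)
    have [measurable]: "q \<in> borel_measurable borel"
      using q(1) by (rule borel_measurable_continuous_onI)
    have "(\<integral>\<^sup>+x\<in>{a..b}. ennreal (q x) \<partial>lborel) \<le> (\<integral>\<^sup>+x. ennreal (q x) \<partial>lborel)"
      by (intro nn_integral_mono) (auto simp: indicator_def)
    moreover have "(\<integral>\<^sup>+x. ennreal (q x) \<partial>lborel) < \<infinity>"
      using small \<open>r > 0\<close> by (auto simp: less_top[symmetric] ennreal_mult_top)
    moreover have "(\<integral>\<^sup>+x\<in>{a..b}. ennreal (q x) \<partial>lborel) = integral {a..b} q"
      by (rule set_nn_integral_lborel_eq_integral)
        (use calculation q0 in \<open>auto simp: set_borel_measurable_def intro: le_less_trans\<close>)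
    ultimately have "ennreal r * ennreal (integral {a..b} q) < ennreal (\<eta>\<^sup>2)"
      using small by (metis mult_left_mono le_less_trans zero_le)
    then have I: "r * integral {a..b} q < \<eta>\<^sup>2"
      using \<open>r > 0\<close> by (simp add: ennreal_mult'[symmetric]) (meson ennreal_leI linorder_not_less)
    have qi: "q integrable_on {a..b}"
      using q(1) by (intro integrable_continuous_interval) (auto intro: continuous_on_subset)
    have F: "(\<psi>' has_integral (\<psi> b - \<psi> a)) {a..b}"
      using ab(3) der by (intro fundamental_theorem_of_calculus)
        (auto simp: has_real_derivative_iff_has_vector_derivative intro: has_vector_derivative_at_within)
    have "norm (integral {a..b} \<psi>') \<le> integral {a..b} (\<lambda>x. \<eta> / r + (r / \<eta>) * q x)"
    proof (rule integral_norm_bound_integral)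
      show "\<psi>' integrable_on {a..b}" using F by blast
      show "(\<lambda>x. \<eta> / r + (r / \<eta>) * q x) integrable_on {a..b}"
        by (intro integrable_add integrable_on_mult_right qi) auto
      fix x
      \<comment> \<open>Whichever side of \<open>\<eta> / r\<close> the value lies on, one of the
        two terms already dominates it.\<close>
      have "\<bar>\<psi>' x\<bar> \<le> \<eta> / r + (r / \<eta>) * (\<psi>' x)\<^sup>2"
      proof (cases "\<bar>\<psi>' x\<bar> \<le> \<eta> / r")
        case False
        then have "\<bar>\<psi>' x\<bar> * (\<eta> / r) \<le> \<bar>\<psi>' x\<bar> * \<bar>\<psi>' x\<bar>" by (intro mult_left_mono) auto
        then have "\<bar>\<psi>' x\<bar> * (\<eta> / r) * (r / \<eta>) \<le> (\<psi>' x)\<^sup>2 * (r / \<eta>)"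
          using \<open>r > 0\<close> \<open>\<eta> > 0\<close> by (intro mult_right_mono) (auto simp: power2_eq_square)
        moreover have "\<bar>\<psi>' x\<bar> * (\<eta> / r) * (r / \<eta>) = \<bar>\<psi>' x\<bar>"
          using \<open>r > 0\<close> \<open>\<eta> > 0\<close> by simp
        moreover have "\<eta> / r > 0" using \<open>r > 0\<close> \<open>\<eta> > 0\<close> by simp
        ultimately show ?thesis by (simp add: mult.commute)
      qed (use \<open>r > 0\<close> \<open>\<eta> > 0\<close> in \<open>simp add: add_increasing2\<close>)
      also have "\<dots> \<le> \<eta> / r + (r / \<eta>) * q x"
        using q(2) \<open>r > 0\<close> \<open>\<eta> > 0\<close> by (intro add_left_mono mult_left_mono) auto
      finally show "norm (\<psi>' x) \<le> \<eta> / r + (r / \<eta>) * q x" by simp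
    qed
    also have "\<dots> = (b - a) * (\<eta> / r) + (r / \<eta>) * integral {a..b} q"
      using ab(3) by (subst Henstock_Kurzweil_Integration.integral_add)
        (auto simp del: times_divide_eq_left intro!: integrable_on_mult_right qi)
    also have "\<dots> \<le> (2 * r) * (\<eta> / r) + (1 / \<eta>) * (r * integral {a..b} q)"
      using ab \<open>r > 0\<close> \<open>\<eta> > 0\<close> by (intro add_mono mult_right_mono) auto
    also have "\<dots> \<le> (2 * r) * (\<eta> / r) + (1 / \<eta>) * \<eta>\<^sup>2"
      using I \<open>\<eta> > 0\<close> by (intro add_left_mono mult_left_mono) auto
    also have "\<dots> = 3 * \<eta>" using \<open>r > 0\<close> \<open>\<eta> > 0\<close> by (simp add: power2_eq_square)
    finally show ?thesis using integral_unique[OF F] by simp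
  qed
  show ?thesis
    using main[of a b] main[of b a] ab by (cases "a \<le> b") (auto simp: abs_minus_commute)
qed

lemma gderiv_pt:
  assumes "\<And>x. GDERIV u x :> g x"
  shows "((\<lambda>a. u (pt a b)) has_real_derivative g (pt a b) $ 1) (at a)"
    and "((\<lambda>b. u (pt a b)) has_real_derivative g (pt a b) $ 2) (at b)"
proof -
  have u: "(u has_derivative (\<lambda>h. h \<bullet> g x)) (at x)" for x using assms by (simp add: gderiv_def)
  have "((\<lambda>a. pt a b) has_derivative (\<lambda>h. h *\<^sub>R axis 1 1)) (at a)"
    unfolding pt_def by (auto intro!: derivative_eq_intros)
  from has_derivative_compose[OF this u]
  show "((\<lambda>a. u (pt a b)) has_real_derivative g (pt a b) $ 1) (at a)"
    by (simp add: has_field_derivative_def inner_commute[of "axis _ _"] mult_commute_abs flip: cart_eq_inner_axis)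
  have "((\<lambda>b. pt a b) has_derivative (\<lambda>h. h *\<^sub>R axis 2 1)) (at b)"
    unfolding pt_def by (auto intro!: derivative_eq_intros)
  from has_derivative_compose[OF this u]
  show "((\<lambda>b. u (pt a b)) has_real_derivative g (pt a b) $ 2) (at b)"
    by (simp add: has_field_derivative_def inner_commute[of "axis _ _"] mult_commute_abs flip: cart_eq_inner_axis)
qed

lemma small_oscillation:
  fixes u :: "real^2 \<Rightarrow> real"
  assumes u: "\<And>x. GDERIV u x :> g x" and g: "continuous_on UNIV g"
    and fin: "integrable lborel (\<lambda>x. (norm (g x))\<^sup>2)" and "\<eta> > 0"
  shows "\<exists>K. compact K \<and> cball 0 R \<subseteq> interior K \<and>
    (\<forall>x\<in>frontier K. \<forall>y\<in>frontier K. \<bar>u x - u y\<bar> \<le> \<eta>)"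
proof -
  \<comment> \<open>Each boundary point reaches the corner \<open>pt r r\<close> along at most two
    sides, at a cost of \<open>3 * \<epsilon>\<close> each; two boundary points make
    \<open>12 * \<epsilon>\<close>.\<close>
  define \<epsilon> where "\<epsilon> = \<eta> / 12"
  have "\<epsilon> > 0" using \<open>\<eta> > 0\<close> by (simp add: \<epsilon>_def)
  define F where "F x = (norm (g x))\<^sup>2" for x
  have contF: "continuous_on UNIV F" unfolding F_def by (intro continuous_intros g)
  have F[measurable]: "(\<lambda>x. ennreal (F x)) \<in> borel_measurable borel"
    using borel_measurable_continuous_onI[OF contF] by measurable
  have finF: "(\<integral>\<^sup>+x. ennreal (F x) \<partial>lborel) < \<infinity>"
    using fin unfolding F_def integrable_iff_bounded by simp
  define G1 where "G1 b = (\<integral>\<^sup>+a. ennreal (F (pt a b)) \<partial>lborel)" for b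
  define G2 where "G2 a = (\<integral>\<^sup>+b. ennreal (F (pt a b)) \<partial>lborel)" for a
  have G[measurable]: "G1 \<in> borel_measurable borel" "G2 \<in> borel_measurable borel"
    unfolding G1_def G2_def using nn_integral_real2(3,4)[OF F] by simp_all
  have IG: "(\<integral>\<^sup>+r. G1 r \<partial>lborel) < \<infinity>" "(\<integral>\<^sup>+r. G2 r \<partial>lborel) < \<infinity>"
    unfolding G1_def G2_def using nn_integral_real2(1,2)[OF F] finF by simp_all
  have refl: "(\<integral>\<^sup>+r. G (- r) \<partial>lborel) = (\<integral>\<^sup>+r. G r \<partial>lborel)"
    if [measurable]: "G \<in> borel_measurable borel" for G :: "real \<Rightarrow> ennreal"
    using nn_integral_real_affine[OF that, of "-1" 0] by simp
  \<comment> \<open>The energy on the four full lines that carry the sides of the square: one radius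
    must be good for all of them.\<close>
  define A where "A r = G1 r + G1 (- r) + G2 r + G2 (- r)" for r
  have "(\<integral>\<^sup>+r. A r \<partial>lborel) = (\<integral>\<^sup>+r. G1 r \<partial>lborel) + (\<integral>\<^sup>+r. G1 r \<partial>lborel)
      + (\<integral>\<^sup>+r. G2 r \<partial>lborel) + (\<integral>\<^sup>+r. G2 r \<partial>lborel)"
    unfolding A_def by (simp add: nn_integral_add refl)
  also have "\<dots> < \<infinity>" using IG by simp
  finally obtain r where r: "r > R" "r > 0" "ennreal r * A r < ennreal (\<epsilon>\<^sup>2)"
    using exists_small_scale[of A "\<epsilon>\<^sup>2" R] \<open>\<epsilon> > 0\<close> by auto
  have small: "ennreal r * c < ennreal (\<epsilon>\<^sup>2)" if "c \<le> A r" for c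
    using r(3) mult_left_mono[OF that, of "ennreal r"] by simp
  have sm: "ennreal r * G1 s < ennreal (\<epsilon>\<^sup>2)" "ennreal r * G2 s < ennreal (\<epsilon>\<^sup>2)" if "\<bar>s\<bar> = r" for s
  proof -
    have "s = r \<or> s = - r" using that by linarith
    then have "G1 s \<le> A r" "G2 s \<le> A r"
      by (auto simp: A_def add_increasing add_increasing2)
    then show "ennreal r * G1 s < ennreal (\<epsilon>\<^sup>2)" "ennreal r * G2 s < ennreal (\<epsilon>\<^sup>2)"
      by (auto intro: small)
  qed
  have comp: "(g x $ i)\<^sup>2 \<le> F x" for x i
    unfolding F_def using component_le_norm_cart[of "g x" i] by (simp add: abs_le_square_iff[symmetric])
  have hor: "\<bar>u (pt b s) - u (pt a s)\<bar> \<le> 3 * \<epsilon>" if "\<bar>s\<bar> = r" "a \<in> {-r..r}" "b \<in> {-r..r}" for a b s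
  proof (rule oscillation_le[where \<psi>="\<lambda>x. u (pt x s)" and \<psi>'="\<lambda>x. g (pt x s) $ 1"
        and q="\<lambda>x. F (pt x s)" and r=r])
    show "continuous_on UNIV (\<lambda>x. F (pt x s))"
      by (intro continuous_on_compose2[OF contF] continuous_intros) auto
    show "ennreal r * (\<integral>\<^sup>+x. ennreal (F (pt x s)) \<partial>lborel) < ennreal (\<epsilon>\<^sup>2)"
      using sm(1)[OF that(1)] by (simp add: G1_def)
    show "((\<lambda>x. u (pt x s)) has_real_derivative g (pt x s) $ 1) (at x)" for x
      by (rule gderiv_pt(1)[OF u])
  qed (use that r \<open>\<epsilon> > 0\<close> comp in auto)
  have ver: "\<bar>u (pt s b) - u (pt s a)\<bar> \<le> 3 * \<epsilon>" if "\<bar>s\<bar> = r" "a \<in> {-r..r}" "b \<in> {-r..r}" for a b s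
  proof (rule oscillation_le[where \<psi>="\<lambda>x. u (pt s x)" and \<psi>'="\<lambda>x. g (pt s x) $ 2"
        and q="\<lambda>x. F (pt s x)" and r=r])
    show "continuous_on UNIV (\<lambda>x. F (pt s x))"
      by (intro continuous_on_compose2[OF contF] continuous_intros) auto
    show "ennreal r * (\<integral>\<^sup>+x. ennreal (F (pt s x)) \<partial>lborel) < ennreal (\<epsilon>\<^sup>2)"
      using sm(2)[OF that(1)] by (simp add: G2_def)
    show "((\<lambda>x. u (pt s x)) has_real_derivative g (pt s x) $ 2) (at x)" for x
      by (rule gderiv_pt(2)[OF u])
  qed (use that r \<open>\<epsilon> > 0\<close> comp in auto)
  define K where "K = cbox (pt (-r) (-r)) (pt r r)"
  have mem: "x \<in> K \<longleftrightarrow> \<bar>x $ 1\<bar> \<le> r \<and> \<bar>x $ 2\<bar> \<le> r" for x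
    by (auto simp: K_def mem_box Basis_real2 simp flip: cart_eq_inner_axis)
  have memi: "x \<in> interior K \<longleftrightarrow> \<bar>x $ 1\<bar> < r \<and> \<bar>x $ 2\<bar> < r" for x
    by (auto simp: K_def mem_box Basis_real2 simp flip: cart_eq_inner_axis)
  have fr: "\<bar>u x - u (pt r r)\<bar> \<le> 6 * \<epsilon>" if "x \<in> frontier K" for x
  proof -
    have "x \<in> K" "x \<notin> interior K" using that by (auto simp: frontier_def K_def)
    then have le: "\<bar>x $ 1\<bar> \<le> r" "\<bar>x $ 2\<bar> \<le> r" and eq: "\<bar>x $ 1\<bar> = r \<or> \<bar>x $ 2\<bar> = r"
      unfolding mem memi by auto
    show ?thesis
      using eq
    proof
      assume 1: "\<bar>x $ 1\<bar> = r"
      have "\<bar>u (pt (x $ 1) (x $ 2)) - u (pt (x $ 1) r)\<bar> \<le> 3 * \<epsilon>" using le r by (intro ver[OF 1]) auto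
      moreover have "\<bar>u (pt (x $ 1) r) - u (pt r r)\<bar> \<le> 3 * \<epsilon>" using le r by (intro hor) auto
      ultimately show ?thesis by simp
    next
      assume 2: "\<bar>x $ 2\<bar> = r"
      have "\<bar>u (pt (x $ 1) (x $ 2)) - u (pt r (x $ 2))\<bar> \<le> 3 * \<epsilon>" using le r by (intro hor[OF 2]) auto
      moreover have "\<bar>u (pt r (x $ 2)) - u (pt r r)\<bar> \<le> 3 * \<epsilon>" using le r by (intro ver) auto
      ultimately show ?thesis by simp
    qed
  qed
  show ?thesis
  proof (intro exI conjI ballI)
    show "compact K" by (simp add: K_def)
    show "cball 0 R \<subseteq> interior K"
    proof
      fix x :: "real^2" assume "x \<in> cball 0 R"
      then show "x \<in> interior K"
        using component_le_norm_cart[of x 1] component_le_norm_cart[of x 2] r(1) unfolding memi by auto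
    qed
    fix x y assume "x \<in> frontier K" "y \<in> frontier K"
    then show "\<bar>u x - u y\<bar> \<le> \<eta>"
      using fr[of x] fr[of y] unfolding \<epsilon>_def by linarith
  qed
qed

section \<open>Functions with a connected critical set\<close>

text \<open>\<open>w\<close> is the normalized stream function, \<open>h\<close> the Bernoulli
  function and \<open>W\<close> the vorticity times the sign used in the normalization.
  \<open>peak\<close> is supplied by Sard and \<open>nonconst\<close> by the choice of that sign;
  the bound \<open>w x \<le> 1\<close> is derived. \<open>W_interior\<close> records what the
  relation between \<open>h\<close> and \<open>w\<close> cannot give where \<open>g\<close>
  vanishes.\<close>

locale single_peak =
  fixes w h W :: "real^2 \<Rightarrow> real" and g :: "real^2 \<Rightarrow> real^2"
  assumes w: "\<And>x. GDERIV w x :> g x"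
    and h: "\<And>x. GDERIV h x :> W x *\<^sub>R g x"
    and g: "continuous_on UNIV g" and W: "continuous_on UNIV W"
    and W_interior: "\<And>x. x \<in> interior {x. g x = 0} \<Longrightarrow> W x = 0"
    and osc: "\<And>\<eta> R. \<eta> > 0 \<Longrightarrow> \<exists>K. compact K \<and> cball 0 R \<subseteq> interior K \<and>
      (\<forall>x\<in>frontier K. \<forall>y\<in>frontier K. \<bar>w x - w y\<bar> \<le> \<eta>)"
    and conn: "connected {x. g x = 0}" and critical: "\<exists>x. g x = 0"
    and peak: "\<And>x. g x = 0 \<Longrightarrow> w x = 1" and nonconst: "\<exists>x. w x < 1"
begin

section \<open>The critical set as bounded set of maxima, and decay at infinity\<close>

lemma contw: "continuous_on A w"
  using w has_derivative_continuous unfolding gderiv_def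
  by (blast intro: continuous_at_imp_continuous_on)

text \<open>Small oscillation says that the frontier values are nearly equal, but not how large they
  are. The minimum over a square containing \<open>x\<close> is below 1, hence not at a critical
  point, hence on the frontier: so all frontier values exceed \<open>w x\<close> by at most
  \<open>\<eta>\<close>.\<close>

lemma low_frontier:
  assumes "w x < b" "b \<le> 1"
  obtains K where "compact K" "cball 0 R \<subseteq> interior K" "\<And>y. y \<in> frontier K \<Longrightarrow> w y < b"
proof -
  define \<eta> where "\<eta> = (b - w x) / 2"
  have "\<eta> > 0" using assms by (simp add: \<eta>_def)
  then obtain K where K: "compact K" "cball 0 (max R (norm x)) \<subseteq> interior K"
      "\<And>y z. y \<in> frontier K \<Longrightarrow> z \<in> frontier K \<Longrightarrow> \<bar>w y - w z\<bar> \<le> \<eta>"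
    using osc by metis
  have "x \<in> cball 0 (max R (norm x))" by simp
  then have x: "x \<in> K" using K(2) interior_subset by blast
  then obtain z where z: "z \<in> K" "\<And>y. y \<in> K \<Longrightarrow> w z \<le> w y" "z \<in> frontier K \<or> g z = 0"
    using gderiv_compact_min[OF w K(1)] by blast
  have "w z < 1" using z(2)[OF x] assms by simp
  then have zf: "z \<in> frontier K" using z(3) peak[of z] by auto
  show ?thesis
  proof
    show "compact K" by fact
    show "cball 0 R \<subseteq> interior K" using K(2) by (meson max.cobounded1 order_trans subset_cball)
    fix y assume "y \<in> frontier K"
    then have "w y \<le> w z + \<eta>" using K(3)[OF _ zf] by (smt (verit))
    then show "w y < b" using z(2)[OF x] assms by (simp add: \<eta>_def field_simps)
  qed
qed

lemma le_1: "w x \<le> 1"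
proof -
  obtain x0 where "w x0 < 1" using nonconst by blast
  then obtain K where K: "compact K" "cball 0 (norm x) \<subseteq> interior K" "\<And>y. y \<in> frontier K \<Longrightarrow> w y < 1"
    using low_frontier by blast
  have x: "x \<in> K" using K(2) interior_subset by force
  then obtain z where "\<And>y. y \<in> K \<Longrightarrow> w y \<le> w z" "z \<in> frontier K \<or> g z = 0"
    using gderiv_compact_max[OF w K(1)] by blast
  then show ?thesis using x K(3) peak by (metis less_eq_real_def order_trans)
qed

lemma g_eq_0_iff: "g x = 0 \<longleftrightarrow> w x = 1"
  using peak gderiv_eq_0_at_max[OF w, of x] le_1 by auto

text \<open>The critical set has value 1 and cannot cross a frontier on which \<open>w\<close> is
  below 1; being connected, it stays on the side of \<open>s\<close>.\<close>

lemma bounded_critical: "bounded {x. g x = 0}"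
proof -
  obtain x0 s where x0: "w x0 < 1" and s: "g s = 0" using nonconst critical by blast
  then obtain K where K: "compact K" "cball 0 (norm s) \<subseteq> interior K" "\<And>y. y \<in> frontier K \<Longrightarrow> w y < 1"
    using low_frontier by blast
  have "s \<in> K" using K(2) interior_subset by force
  have "{x. g x = 0} \<inter> frontier K = {}" using K(3) peak by force
  then have "{x. g x = 0} - K = {}"
    using connected_Int_frontier[OF conn, of K] s \<open>s \<in> K\<close> by blast
  then show ?thesis
    using compact_imp_bounded[OF K(1)] bounded_subset by blast
qed

text \<open>Fills the gaps between the good squares: beyond a square \<open>K\<close> containing all
  critical points, the maximum over the region between \<open>K\<close> and a larger square lies on
  one of the two frontiers, where \<open>w\<close> is below \<open>b\<close>.\<close>

lemma eventually_less:
  assumes "w x < b"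
  shows "\<forall>\<^sub>F y in at_infinity. w y < b"
proof (cases "b \<le> 1")
  case False
  then show ?thesis using le_1 by (intro always_eventually) (smt (verit))
next
  case True
  obtain R where R: "{x. g x = 0} \<subseteq> cball 0 R"
    using bounded_critical unfolding bounded_iff subset_iff mem_cball_0 by blast
  obtain K where K: "compact K" "cball 0 R \<subseteq> interior K" "\<And>y. y \<in> frontier K \<Longrightarrow> w y < b"
    using low_frontier[OF assms True] by blast
  obtain B where B: "K \<subseteq> cball 0 B"
    using compact_imp_bounded[OF K(1)] unfolding bounded_iff subset_iff mem_cball_0 by blast
  have "w y < b" if "y \<notin> K" for y :: "real^2"
  proof -
    obtain M where M: "compact M" "cball 0 (max B (norm y)) \<subseteq> interior M" "\<And>y. y \<in> frontier M \<Longrightarrow> w y < b"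
      using low_frontier[OF assms True] by blast
    define A where "A = M \<inter> - interior K"
    have "y \<in> cball 0 (max B (norm y))" by simp
    then have "y \<in> M" using M(2) interior_subset by blast
    then have y: "y \<in> A" using that interior_subset by (auto simp: A_def)
    moreover have "compact A" unfolding A_def by (intro compact_Int_closed M) auto
    ultimately obtain z where z: "z \<in> A" "\<And>y. y \<in> A \<Longrightarrow> w y \<le> w z" "z \<in> frontier A \<or> g z = 0"
      using gderiv_compact_max[OF w, of A] by blast
    have "g z \<noteq> 0" using z(1) R K(2) by (auto simp: A_def)
    then have "z \<in> frontier A" using z(3) by simp
    then have "z \<in> frontier M \<union> frontier K"
      using frontier_Int_subset[of M "- interior K"] frontier_interior_subset[of K]
      unfolding A_def by (auto simp: frontier_complement)
    then have "w z < b" using M(3) K(3) by blast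
    then show ?thesis using z(2)[OF y] by simp
  qed
  moreover have "\<forall>\<^sub>F y in at_infinity. y \<notin> K"
    unfolding eventually_at_infinity
  proof (intro exI[of _ "B + 1"] allI impI)
    fix y :: "real^2" assume "B + 1 \<le> norm y"
    then show "y \<notin> K" using B by (auto simp: subset_iff)
  qed
  ultimately show ?thesis by (auto elim: eventually_mono)
qed

definition L :: ereal where "L = (INF x. ereal (w x))"

lemma L_le: "L \<le> ereal (w x)"
  unfolding L_def by (rule INF_lower) simp

lemma L_lessD: "L < ereal t \<Longrightarrow> \<exists>x. w x < t"
  by (simp add: L_def INF_less_iff)

lemma L_less_1: "L < 1"
  using nonconst L_le by (metis le_less_trans less_ereal.simps(1) one_ereal_def)

text \<open>An attained infimum would be a critical value, hence 1, against \<open>nonconst\<close>.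
  So the range avoids \<open>L\<close>, as the half-open domain of \<open>f\<close>
  requires.\<close>

lemma L_less: "L < ereal (w x)"
proof (rule ccontr)
  assume "\<not> ?thesis"
  then have "w x \<le> w y" for y using L_le[of y] by (metis ereal_less_eq(3) linorder_not_less order_trans)
  then have "- g x = 0"
    by (intro gderiv_eq_0_at_max[OF GDERIV_minus[OF w], of x]) auto
  then have "w x = 1" using peak by simp
  then show False using nonconst \<open>\<And>y. w x \<le> w y\<close> by (metis linorder_not_less)
qed

lemma tendsto_L: "((\<lambda>x. ereal (w x)) \<longlongrightarrow> L) at_infinity"
proof (rule order_tendstoI)
  fix a assume "a < L"
  then show "\<forall>\<^sub>F x in at_infinity. a < ereal (w x)"
    using L_le less_le_trans by (intro always_eventually) blast
next
  fix b assume "L < b"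
  then obtain x where x: "ereal (w x) < b"
    by (auto simp: L_def INF_less_iff)
  then obtain c where c: "ereal (w x) < ereal c" "ereal c < b"
    using ereal_dense2 by blast
  have "\<forall>\<^sub>F y in at_infinity. w y < c" using eventually_less c(1) by simp
  then show "\<forall>\<^sub>F y in at_infinity. ereal (w y) < b"
    by eventually_elim (use c(2) in \<open>metis less_ereal.simps(1) less_trans\<close>)
qed

section \<open>Connectedness of superlevel, sublevel and level sets\<close>

lemma superlevel_compact:
  assumes "L < ereal t"
  shows "compact {x. t \<le> w x}"
proof -
  have "\<forall>\<^sub>F y in at_infinity. w y < t" using L_lessD[OF assms] eventually_less by blast
  then obtain b where "\<And>y. b \<le> norm y \<Longrightarrow> w y < t" unfolding eventually_at_infinity by blast
  then have "{x. t \<le> w x} \<subseteq> cball 0 b" by (force simp: not_le[symmetric])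
  moreover have "closed {x. t \<le> w x}"
    by (intro closed_Collect_le contw continuous_intros)
  ultimately show ?thesis
    using bounded_subset[OF bounded_cball] compact_eq_bounded_closed by blast
qed

lemma superlevel_connected:
  assumes "L < ereal t"
  shows "connected {x. t \<le> w x}"
proof -
  let ?K = "{x. t \<le> w x}"
  have K: "compact ?K" by (rule superlevel_compact[OF assms])
  have meets: "\<exists>z. connected_component ?K x z \<and> g z = 0" if x: "x \<in> ?K" for x
  proof -
    let ?C = "connected_component_set ?K x"
    have "closed ?C" by (rule closed_connected_component[OF compact_imp_closed[OF K]])
    then have "compact ?C"
      using compact_Int_closed[OF K] connected_component_subset by (metis inf.absorb_iff2)
    moreover have "?C \<noteq> {}" using connected_component_refl[OF x] by blast
    ultimately obtain z where z: "z \<in> ?C" "\<And>y. y \<in> ?C \<Longrightarrow> w y \<le> w z"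
      using gderiv_compact_max[OF w, of ?C] by blast
    \<comment> \<open>A maximum over one component only: but a short gradient segment from
      \<open>z\<close> stays in the superlevel set, hence in the component of \<open>z\<close>, and
      would reach higher values.\<close>
    have "g z = 0"
    proof (rule ccontr)
      assume "g z \<noteq> 0"
      then obtain d where "d > 0" and d: "\<And>r. 0 < r \<Longrightarrow> r < d \<Longrightarrow> w (z + r *\<^sub>R g z) > w z"
        using gderiv_ascent[OF w] by blast
      have zK: "t \<le> w z" using z(1) connected_component_in by blast
      have "z + r *\<^sub>R g z \<in> ?K" if "0 \<le> r" "r < d" for r
        using d[of r] that zK by (cases "r = 0") auto
      then have "(\<lambda>r. z + r *\<^sub>R g z) ` {0..d/2} \<subseteq> ?K" using \<open>d > 0\<close> by force
      moreover have "connected ((\<lambda>r. z + r *\<^sub>R g z) ` {0..d/2})"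
        by (intro connected_continuous_image continuous_intros) auto
      moreover have "z \<in> (\<lambda>r. z + r *\<^sub>R g z) ` {0..d/2}"
        using \<open>d > 0\<close> by (auto intro!: image_eqI[of _ _ 0])
      moreover have "z + (d/2) *\<^sub>R g z \<in> (\<lambda>r. z + r *\<^sub>R g z) ` {0..d/2}"
        using \<open>d > 0\<close> by auto
      ultimately have "connected_component ?K z (z + (d/2) *\<^sub>R g z)"
        unfolding connected_component_def by blast
      then have "z + (d/2) *\<^sub>R g z \<in> ?C"
        using z(1) connected_component_trans by fastforce
      then show False using z(2) d[of "d/2"] \<open>d > 0\<close> by fastforce
    qed
    then show ?thesis using z(1) by blast
  qed
  show ?thesis
    unfolding connected_iff_connected_component
  proof (intro ballI)
    fix x y assume "x \<in> ?K" "y \<in> ?K"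
    then obtain p q where p: "connected_component ?K x p" "g p = 0"
      and q: "connected_component ?K y q" "g q = 0" using meets by blast
    have "t \<le> 1" using \<open>x \<in> ?K\<close> le_1[of x] by simp
    \<comment> \<open>The connected critical set lies in the superlevel set and joins all
      components.\<close>
    then have "{x. g x = 0} \<subseteq> ?K" using peak by auto
    then have "connected_component ?K p q"
      unfolding connected_component_def using conn p(2) q(2) by blast
    then show "connected_component ?K x y"
      using p(1) q(1) by (meson connected_component_sym connected_component_trans)
  qed
qed

text \<open>A bounded component would be compact and have a minimum point, regular since its value
  is at most \<open>t < 1\<close>; descending from there stays in the component. So every component
  leaves a ball outside which \<open>w\<close> is below \<open>t\<close>, and the complement of a
  ball in the plane is connected.\<close>

lemma sublevel_connected:
  assumes "L < ereal t" "t < 1"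
  shows "connected {x. w x \<le> t}"
proof -
  let ?K = "{x. w x \<le> t}"
  have clK: "closed ?K"
    by (intro closed_Collect_le contw continuous_intros)
  have unbdd: "\<not> bounded (connected_component_set ?K x)" if x: "x \<in> ?K" for x
  proof
    let ?C = "connected_component_set ?K x"
    assume "bounded ?C"
    then have "compact ?C" using closed_connected_component[OF clK] compact_eq_bounded_closed by blast
    moreover have "?C \<noteq> {}" using connected_component_refl[OF x] by blast
    ultimately obtain z where z: "z \<in> ?C" "\<And>y. y \<in> ?C \<Longrightarrow> w z \<le> w y"
      using gderiv_compact_min[OF w, of ?C] by blast
    have zK: "w z \<le> t" using z(1) connected_component_in by blast
    then have "- g z \<noteq> 0" using peak[of z] \<open>t < 1\<close> by auto
    then obtain d where "d > 0" and "\<And>r. 0 < r \<Longrightarrow> r < d \<Longrightarrow> - w (z + r *\<^sub>R - g z) > - w z"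
      using gderiv_ascent[OF GDERIV_minus[OF w]] by blast
    then have d: "\<And>r. 0 < r \<Longrightarrow> r < d \<Longrightarrow> w (z + r *\<^sub>R - g z) < w z"
      by simp
    have "z + r *\<^sub>R - g z \<in> ?K" if "0 \<le> r" "r < d" for r
      using d[of r] that zK by (cases "r = 0") auto
    then have "(\<lambda>r. z + r *\<^sub>R - g z) ` {0..d/2} \<subseteq> ?K" using \<open>d > 0\<close> by force
    moreover have "connected ((\<lambda>r. z + r *\<^sub>R - g z) ` {0..d/2})"
      by (intro connected_continuous_image continuous_intros) auto
    moreover have "z \<in> (\<lambda>r. z + r *\<^sub>R - g z) ` {0..d/2}"
      using \<open>d > 0\<close> by (auto intro!: image_eqI[of _ _ 0])
    moreover have "z + (d/2) *\<^sub>R - g z \<in> (\<lambda>r. z + r *\<^sub>R - g z) ` {0..d/2}"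
      using \<open>d > 0\<close> by auto
    ultimately have "connected_component ?K z (z + (d/2) *\<^sub>R - g z)"
      unfolding connected_component_def by blast
    then have "z + (d/2) *\<^sub>R - g z \<in> ?C"
      using z(1) connected_component_trans by fastforce
    then show False using z(2) d[of "d/2"] \<open>d > 0\<close> by fastforce
  qed
  obtain B where B: "{x. t \<le> w x} \<subseteq> cball 0 B"
    using compact_imp_bounded[OF superlevel_compact[OF assms(1)]]
    unfolding bounded_iff subset_iff mem_cball_0 by blast
  have out: "- cball 0 B \<subseteq> ?K" using B by force
  have outc: "connected (- cball (0::real^2) B)"
    by (intro connected_complement_bounded_convex) auto
  have meets: "\<exists>z. connected_component ?K x z \<and> z \<notin> cball 0 B" if x: "x \<in> ?K" for x
    using unbdd[OF x] bounded_subset[OF bounded_cball] by blast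
  show ?thesis
    unfolding connected_iff_connected_component
  proof (intro ballI)
    fix x y assume "x \<in> ?K" "y \<in> ?K"
    then obtain p q where p: "connected_component ?K x p" "p \<notin> cball 0 B"
      and q: "connected_component ?K y q" "q \<notin> cball 0 B" using meets by blast
    then have "connected_component ?K p q"
      unfolding connected_component_def using out outc by blast
    then show "connected_component ?K x y"
      using p(1) q(1) by (meson connected_component_sym connected_component_trans)
  qed
qed

lemma level_connected:
  assumes "L < ereal t" "t < 1"
  shows "connected {x. w x = t}"
proof -
  have "connected ({x. t \<le> w x} \<inter> {x. w x \<le> t})"
  proof (rule unicoherentD[OF unicoherent_UNIV])
    show "closedin (top_of_set UNIV) {x. t \<le> w x}" "closedin (top_of_set UNIV) {x. w x \<le> t}"
      by (auto intro!: closed_Collect_le contw continuous_intros)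
  qed (use superlevel_connected sublevel_connected assms in auto)
  moreover have "{x. t \<le> w x} \<inter> {x. w x \<le> t} = {x. w x = t}" by auto
  ultimately show ?thesis by simp
qed

section \<open>The vorticity as a continuous function of the stream function\<close>

lemma h_eq:
  assumes "w x = w y" "w x < 1"
  shows "h x = h y"
proof (rule connected_local_const[OF level_connected[of "w x"]])
  show "\<forall>a\<in>{z. w z = w x}. \<forall>\<^sub>F b in at a within {z. w z = w x}. h a = h b"
  proof
    fix a assume a: "a \<in> {z. w z = w x}"
    then have "g a \<noteq> 0" using peak[of a] assms by auto
    moreover have "isCont g a" using g continuous_on_eq_continuous_at by blast
    ultimately have "\<forall>\<^sub>F b in nhds a. w b = w a \<longrightarrow> h b = h a"
      by (intro locally_constant_on_level_set[OF w h])
    then show "\<forall>\<^sub>F b in at a within {z. w z = w x}. h a = h b"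
      unfolding eventually_at_filter by eventually_elim (use a in auto)
  qed
qed (use assms L_less in auto)

text \<open>\<open>W x\<close> is the limit of right difference quotients of \<open>H\<close> at
  \<open>w x\<close>, and limits are unique. The ascending ray is used only while \<open>w\<close>
  is below 1, the range in which \<open>h\<close> is known to factor through
  \<open>w\<close>.\<close>

lemma W_eq_below:
  assumes "w x = w y" "w x < 1"
  shows "W x = W y"
proof -
  define H where "H t = h (SOME z. w z = t)" for t
  have H: "h z = H (w z)" if "w z < 1" for z
    unfolding H_def using h_eq[of z "SOME z'. w z' = w z"] that someI[of "\<lambda>z'. w z' = w z" z] by auto
  have "((\<lambda>t. (H t - H (w z)) / (t - w z)) \<longlongrightarrow> W z) (at_right (w z))" if "w z < 1" for z
    by (rule quotient_tendsto_along_gradient[OF w h, of z 1 H]) (use that H peak[of z] in auto)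
  then show ?thesis
    using assms tendsto_unique[OF trivial_limit_at_right_real] by metis
qed

text \<open>\<open>w\<close> is open at \<open>x\<close> as a map into the interval (L, 1]. If
  \<open>w x < 1\<close>, the point is regular, so no local extremum; if \<open>w x = 1\<close>,
  only lower values matter, and they occur arbitrarily near because \<open>x\<close> is not
  interior. Connectedness of the image of the ball fills in the rest.\<close>

lemma values_nearby:
  assumes x: "x \<notin> interior {x. g x = 0}" and "\<delta> > 0"
  shows "\<forall>\<^sub>F t in at (w x) within {t. L < ereal t \<and> t \<le> 1}. t \<in> w ` ball x \<delta>"
proof -
  have conn_im: "connected (w ` ball x \<delta>)" by (intro connected_continuous_image contw) auto
  have xb: "x \<in> ball x \<delta>" using \<open>\<delta> > 0\<close> by simp
  have "\<not> ball x \<delta> \<subseteq> {x. g x = 0}"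
    using x xb interior_maximal by blast
  then obtain y where y: "y \<in> ball x \<delta>" "w y < 1"
    using g_eq_0_iff le_1 less_eq_real_def by blast
  have below: "\<exists>y\<in>ball x \<delta>. w y < w x"
  proof (rule ccontr)
    assume c: "\<not> ?thesis"
    have "\<forall>\<^sub>F z in nhds x. z \<in> ball x \<delta>" using xb by (intro eventually_nhds_in_open) auto
    then have "\<forall>\<^sub>F z in nhds x. - w z \<le> - w x"
      by eventually_elim (use c in force)
    then have "- g x = 0" by (intro gderiv_eq_0_at_max[OF GDERIV_minus[OF w]])
    then have "w x = 1" using peak by simp
    then show False using c y by auto
  qed
  have above: "\<exists>b>w x. \<forall>t. w x \<le> t \<and> t < b \<and> t \<le> 1 \<longrightarrow> t \<in> w ` ball x \<delta>"
  proof (cases "w x = 1")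
    case True
    \<comment> \<open>Any bound above 1 works: \<open>t \<le> 1\<close> leaves only
      \<open>t = 1\<close>.\<close>
    then show ?thesis using xb by (intro exI[of _ 2]) force
  next
    case False
    have "\<exists>y\<in>ball x \<delta>. w y > w x"
    proof (rule ccontr)
      assume c: "\<not> ?thesis"
      have "\<forall>\<^sub>F z in nhds x. z \<in> ball x \<delta>" using xb by (intro eventually_nhds_in_open) auto
      then have "\<forall>\<^sub>F z in nhds x. w z \<le> w x"
        by eventually_elim (use c in force)
      then show False using gderiv_eq_0_at_max[OF w] peak False by blast
    qed
    then obtain z where "z \<in> ball x \<delta>" "w z > w x" by blast
    then show ?thesis
      using connectedD_interval[OF conn_im, of "w x" "w z"] xb
      by (intro exI[of _ "w z"]) (auto intro!: imageI)
  qed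
  obtain z where z: "z \<in> ball x \<delta>" "w z < w x" using below by blast
  obtain b where b: "b > w x" "\<And>t. w x \<le> t \<Longrightarrow> t < b \<Longrightarrow> t \<le> 1 \<Longrightarrow> t \<in> w ` ball x \<delta>"
    using above by blast
  have "t \<in> w ` ball x \<delta>" if "t \<in> {w z<..<b}" "t \<le> 1" for t
  proof (cases "t \<le> w x")
    case True
    then show ?thesis
      using connectedD_interval[OF conn_im, of "w z" "w x" t] xb z that by (auto intro!: imageI)
  qed (use b that in auto)
  moreover have "\<forall>\<^sub>F t in nhds (w x). t \<in> {w z<..<b}"
    using z b(1) by (intro eventually_nhds_in_open) auto
  ultimately show ?thesis
    unfolding eventually_at_filter by (auto elim!: eventually_mono)
qed

text \<open>Near both points \<open>w\<close> takes a common value \<open>t\<close> slightly below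
  1, where \<open>W\<close> depends on \<open>t\<close> alone; continuity of \<open>W\<close>
  carries this to the points themselves.\<close>

lemma W_eq_boundary:
  assumes x: "g x = 0" "x \<notin> interior {x. g x = 0}" and y: "g y = 0" "y \<notin> interior {x. g x = 0}"
  shows "W x = W y"
proof (rule ccontr)
  assume "W x \<noteq> W y"
  define e where "e = \<bar>W x - W y\<bar> / 2"
  have "e > 0" using \<open>W x \<noteq> W y\<close> by (simp add: e_def)
  have "isCont W x" "isCont W y" using W continuous_on_eq_continuous_at by blast+
  then obtain d1 d2 where d: "d1 > 0" "d2 > 0" "\<And>z. dist z x < d1 \<Longrightarrow> dist (W z) (W x) < e"
      "\<And>z. dist z y < d2 \<Longrightarrow> dist (W z) (W y) < e"
    unfolding continuous_at_eps_delta using \<open>e > 0\<close> by metis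
  let ?F = "at (1::real) within {t. L < ereal t \<and> t \<le> 1}"
  have wxy: "w x = 1" "w y = 1" using x y peak by auto
  have "\<forall>\<^sub>F t in ?F. t \<in> w ` ball x d1 \<and> t \<in> w ` ball y d2 \<and> t < 1"
    using values_nearby[OF x(2) d(1)] values_nearby[OF y(2) d(2)] wxy
    by (auto simp: eventually_at_filter elim: eventually_elim2)
  \<comment> \<open>Values below 1 accumulate at 1 inside the interval, so the eventual statement is
    not vacuous.\<close>
  moreover have "?F \<noteq> bot"
  proof -
    obtain x0 where x0: "w x0 < 1" using nonconst by blast
    have "L < ereal t" if "w x0 \<le> t" for t
      using L_less[of x0] that by (metis ereal_less_eq(3) less_le_trans)
    then have "{w x0<..<1} \<subseteq> {t. L < ereal t \<and> t \<le> 1}" by auto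
    moreover have "at 1 within {w x0<..<1} \<noteq> bot"
      using x0 by (simp add: at_within_eq_bot_iff closure_greaterThanLessThan)
    ultimately show ?thesis
      using at_le by (metis bot.extremum_uniqueI)
  qed
  ultimately obtain t where t: "t \<in> w ` ball x d1" "t \<in> w ` ball y d2" "t < 1"
    using eventually_happens' by blast
  obtain p where p: "dist p x < d1" "w p = t" using t(1) by (metis dist_commute imageE mem_ball)
  obtain q where q: "dist q y < d2" "w q = t" using t(2) by (metis dist_commute imageE mem_ball)
  have "W p = W q" using W_eq_below p q t(3) by auto
  then show False
    using d(3)[OF p(1)] d(4)[OF q(1)] unfolding e_def dist_real_def by (smt (verit) field_sum_of_halves)
qed

lemma critical_ne_UNIV: "{x. g x = 0} \<noteq> UNIV"
  using nonconst peak by (metis UNIV_I mem_Collect_eq order_less_irrefl)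

lemma exists_boundary: "\<exists>x. g x = 0 \<and> x \<notin> interior {x. g x = 0}"
proof (rule ccontr)
  assume "\<not> ?thesis"
  then have "open {x. g x = 0}"
    using interior_subset by (metis (mono_tags, lifting) Collect_mem_eq Collect_mono open_interior subset_antisym mem_Collect_eq)
  moreover have "closed {x. g x = 0}"
    by (intro closed_Collect_eq g continuous_intros)
  ultimately have "{x. g x = 0} = {} \<or> {x. g x = 0} = UNIV"
    by (simp only: clopen[symmetric] simp_thms)
  moreover have "{x. g x = 0} \<noteq> {}" using critical by simp
  ultimately show False using critical_ne_UNIV by argo
qed

text \<open>If the critical set has interior, \<open>W\<close> vanishes there and, by continuity, at
  a frontier point of the interior, which is a boundary critical point; \<open>W_eq_boundary\<close>
  spreads the zero to all the others. Without interior every critical point is a boundary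
  one.\<close>

lemma W_eq_critical:
  assumes "g x = 0" "g y = 0"
  shows "W x = W y"
proof -
  let ?S = "{x. g x = 0}"
  have cl: "closed ?S" by (intro closed_Collect_eq g continuous_intros)
  have zero: "W x = 0" if "interior ?S \<noteq> {}" "g x = 0" for x
  proof (cases "x \<in> interior ?S")
    case False
    have "interior ?S \<noteq> UNIV"
      using interior_subset[of ?S] critical_ne_UNIV by blast
    then have "frontier (interior ?S) \<noteq> {}" using that(1) frontier_eq_empty by blast
    then obtain z where z: "z \<in> closure (interior ?S)" "z \<notin> interior ?S"
      by (auto simp: frontier_def)
    have "closed {x. W x = 0}" by (intro closed_Collect_eq W continuous_intros)
    then have "W z = 0"
      using z(1) closure_minimal[of "interior ?S" "{x. W x = 0}"] W_interior by blast
    moreover have "g z = 0"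
      using z(1) closure_minimal[OF interior_subset cl] by blast
    ultimately show ?thesis using W_eq_boundary[of x z] False z(2) that(2) by simp
  qed (use W_interior in auto)
  show ?thesis
    using zero assms W_eq_boundary[of x y] by (cases "interior ?S = {}") auto
qed

lemma W_eq: "w x = w y \<Longrightarrow> W x = W y"
  using W_eq_critical W_eq_below g_eq_0_iff le_1 by (metis less_eq_real_def)

text \<open>For continuity at \<open>t\<close>, fix a point \<open>x\<close> of that value outside
  the interior of the critical set: values near \<open>t\<close> are attained near \<open>x\<close>,
  where \<open>W\<close> is close to \<open>W x\<close>.\<close>

lemma W_function_of_w:
  obtains f where "continuous_on {t. L < ereal t \<and> t \<le> 1} f" "\<And>x. W x = f (w x)"
proof
  define f where "f t = W (SOME x. w x = t)" for t
  show f: "W x = f (w x)" for x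
    unfolding f_def by (rule W_eq) (metis (mono_tags) someI)
  show "continuous_on {t. L < ereal t \<and> t \<le> 1} f"
    unfolding continuous_on_def
  proof
    let ?T = "{t. L < ereal t \<and> t \<le> 1}"
    fix t assume t: "t \<in> ?T"
    obtain x where x: "w x = t" "x \<notin> interior {x. g x = 0}"
    proof (cases "t = 1")
      case True
      then show ?thesis using that exists_boundary peak by metis
    next
      case False
      obtain y s where "w y < t" "w s = 1" using L_lessD t critical peak by blast
      moreover have "connected (range w)" by (intro connected_continuous_image contw) auto
      ultimately have "t \<in> range w"
        using t connectedD_interval[of "range w" "w y" "w s" t] by auto
      then obtain x where "w x = t" by blast
      then show ?thesis using that peak False interior_subset by blast
    qed
    show "(f \<longlongrightarrow> f t) (at t within ?T)"
    proof (rule tendstoI)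
      fix e :: real assume "e > 0"
      have "isCont W x" using W continuous_on_eq_continuous_at by blast
      then obtain d where d: "d > 0" "\<And>z. dist z x < d \<Longrightarrow> dist (W z) (W x) < e"
        unfolding continuous_at_eps_delta using \<open>e > 0\<close> by metis
      have "\<forall>\<^sub>F s in at t within ?T. s \<in> w ` ball x d"
        using values_nearby[OF x(2) d(1)] x(1) by simp
      then show "\<forall>\<^sub>F s in at t within ?T. dist (f s) (f t) < e"
        by eventually_elim (use d f x(1) in \<open>auto simp: dist_commute\<close>)
    qed
  qed
qed

end

section \<open>Stream function and Bernoulli function\<close>

text \<open>The potential is \<open>\<integral>\<^sub>0\<^sup>1 G (t x) \<bullet> x dt\<close>; by symmetry of the Jacobian the integrand has
  gradient \<open>d/dt (t G (t x))\<close>.\<close>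

lemma symmetric_field_has_potential:
  fixes G :: "real^'n \<Rightarrow> real^'n"
  assumes G: "C1 G" and sym: "\<And>x i j. partial_deriv i G x $ j = partial_deriv j G x $ i"
  obtains u where "\<And>x. GDERIV u x :> G x"
proof -
  define D where "D y h = (\<Sum>i\<in>UNIV. h $ i *\<^sub>R partial_deriv i G y)" for y h
  have der: "(G has_derivative D y) (at y)" for y
    using C1_has_derivative[OF G] unfolding D_def .
  have cG: "continuous_on UNIV G" by (rule C1_continuous[OF G])
  have cP: "continuous_on UNIV (partial_deriv i G)" for i using G by (simp add: C1_def)
  have D_inner: "D y h \<bullet> k = (\<Sum>i\<in>UNIV. \<Sum>j\<in>UNIV. h $ i * partial_deriv i G y $ j * k $ j)" for y h k
  proof -
    have "D y h \<bullet> k = (\<Sum>i\<in>UNIV. h $ i * (partial_deriv i G y \<bullet> k))"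
      by (simp add: D_def inner_sum_left)
    then show ?thesis
      by (simp add: inner_vec_def sum_distrib_left mult.assoc)
  qed
  have Dsym: "D y h \<bullet> k = D y k \<bullet> h" for y h k
  proof -
    have "D y h \<bullet> k = (\<Sum>i\<in>UNIV. \<Sum>j\<in>UNIV. h $ i * partial_deriv i G y $ j * k $ j)"
      by (rule D_inner)
    also have "\<dots> = (\<Sum>j\<in>UNIV. \<Sum>i\<in>UNIV. h $ i * partial_deriv i G y $ j * k $ j)"
      by (rule sum.swap)
    also have "\<dots> = (\<Sum>j\<in>UNIV. \<Sum>i\<in>UNIV. k $ j * partial_deriv j G y $ i * h $ i)"
      by (intro sum.cong refl) (metis sym mult.commute mult.left_commute)
    also have "\<dots> = D y k \<bullet> h"
      by (rule D_inner[symmetric])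
    finally show ?thesis .
  qed
  define q where "q x t = t *\<^sub>R D (t *\<^sub>R x) x + G (t *\<^sub>R x)" for x and t :: real
  define u where "u x = integral (cbox 0 1) (\<lambda>t::real. G (t *\<^sub>R x) \<bullet> x)" for x
  have cq: "continuous_on UNIV (\<lambda>(x, t). q x t)"
    unfolding q_def D_def case_prod_beta
    by (intro continuous_intros continuous_on_compose2[OF cG] continuous_on_compose2[OF cP]) auto
  have "GDERIV u x :> G x" for x
  proof -
    have "((\<lambda>x. integral (cbox 0 1) (\<lambda>t::real. G (t *\<^sub>R x) \<bullet> x)) has_derivative
        integral (cbox 0 1) (\<lambda>t. blinfun_inner_right (q x t))) (at x within UNIV)"
    proof (rule leibniz_rule)
      fix x :: "real^'n" and t :: real
      have "((\<lambda>x. t *\<^sub>R x) has_derivative (\<lambda>h. t *\<^sub>R h)) (at x)"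
        by (auto intro!: derivative_eq_intros)
      from has_derivative_compose[OF this der]
      have "((\<lambda>x. G (t *\<^sub>R x)) has_derivative (\<lambda>h. D (t *\<^sub>R x) (t *\<^sub>R h))) (at x)" .
      from has_derivative_inner[OF this has_derivative_ident]
      have "((\<lambda>x. G (t *\<^sub>R x) \<bullet> x) has_derivative
          (\<lambda>h. G (t *\<^sub>R x) \<bullet> h + D (t *\<^sub>R x) (t *\<^sub>R h) \<bullet> x)) (at x)" .
      moreover have "G (t *\<^sub>R x) \<bullet> h + D (t *\<^sub>R x) (t *\<^sub>R h) \<bullet> x = q x t \<bullet> h" for h
        using Dsym[of "t *\<^sub>R x" "t *\<^sub>R h" x] by (simp add: q_def inner_add_left)
      ultimately show "((\<lambda>x. G (t *\<^sub>R x) \<bullet> x) has_derivative blinfun_apply (blinfun_inner_right (q x t))) (at x within UNIV)"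
        by simp
    next
      fix x show "(\<lambda>t. G (t *\<^sub>R x) \<bullet> x) integrable_on cbox 0 1"
        by (intro integrable_continuous continuous_intros continuous_on_compose2[OF cG]) auto
    next
      show "continuous_on (UNIV \<times> cbox 0 1) (\<lambda>(x, t). blinfun_inner_right (q x t))"
        using continuous_on_subset[OF bounded_linear.continuous_on[OF bounded_linear_blinfun_inner_right cq]]
        by (simp add: case_prod_beta')
    qed auto
    moreover have "((\<lambda>t. blinfun_inner_right (q x t)) has_integral blinfun_inner_right (G x)) (cbox 0 1)"
    proof -
      have "(q x has_integral (1 *\<^sub>R G (1 *\<^sub>R x) - 0 *\<^sub>R G (0 *\<^sub>R x))) {0..1}"
      proof (rule fundamental_theorem_of_calculus)
        fix t :: real
        have "((\<lambda>t. t *\<^sub>R x) has_derivative (\<lambda>s. s *\<^sub>R x)) (at t)"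
          by (auto intro!: derivative_eq_intros)
        from has_derivative_compose[OF this der]
        have "((\<lambda>t. G (t *\<^sub>R x)) has_derivative (\<lambda>s. D (t *\<^sub>R x) (s *\<^sub>R x))) (at t)" .
        moreover have "D (t *\<^sub>R x) (s *\<^sub>R x) = s *\<^sub>R D (t *\<^sub>R x) x" for s
          by (simp add: D_def scaleR_sum_right)
        ultimately have "((\<lambda>t. G (t *\<^sub>R x)) has_vector_derivative D (t *\<^sub>R x) x) (at t)"
          by (simp add: has_vector_derivative_def)
        then have "((\<lambda>t. t *\<^sub>R G (t *\<^sub>R x)) has_vector_derivative q x t) (at t)"
          unfolding q_def by (auto intro!: derivative_eq_intros)
        then show "((\<lambda>t. t *\<^sub>R G (t *\<^sub>R x)) has_vector_derivative q x t) (at t within {0..1})"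
          by (rule has_vector_derivative_at_within)
      qed simp
      from has_integral_linear[OF this bounded_linear_blinfun_inner_right]
      show ?thesis by (simp add: o_def)
    qed
    moreover have "blinfun_apply (blinfun_inner_right (G x)) = (\<lambda>h. h \<bullet> G x)"
      by (simp add: fun_eq_iff inner_commute)
    ultimately show ?thesis
      unfolding gderiv_def u_def[abs_def] by (simp only: integral_unique)
  qed
  then show ?thesis using that by blast
qed

lemma perp_nth [simp]: "perp g $ 1 = - g $ 2" "perp g $ 2 = g $ 1"
  by (simp_all add: perp_def)

lemma perp_perp [simp]: "perp (perp g) = - g"
  by (simp add: vec_eq_iff forall_2)

lemma perp_minus [simp]: "perp (- g) = - perp g"
  by (simp add: vec_eq_iff forall_2)

lemma norm_perp [simp]: "norm (perp g) = norm g"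
  by (simp add: norm_vec_def L2_set_def sum_2 add.commute)

lemma perp_eq_0_iff [simp]: "perp g = 0 \<longleftrightarrow> g = 0"
  using norm_perp[of g] by (metis norm_eq_zero)

lemma bounded_linear_neg_perp: "bounded_linear (\<lambda>x. - perp x)"
  unfolding linear_conv_bounded_linear[symmetric]
  by (auto simp: linear_iff vec_eq_iff forall_2)

lemma stream_function_iff: "stream_function u v \<longleftrightarrow> (\<forall>x. GDERIV u x :> - perp (v x))"
proof -
  have "v x = perp g \<longleftrightarrow> g = - perp (v x)" for x g
    by (metis add.inverse_inverse perp_minus perp_perp)
  then show ?thesis unfolding stream_function_def by simp
qed

text \<open>Off the diagonal, symmetry of the Jacobian of \<open>- perp v\<close> is precisely the
  vanishing of the divergence of \<open>v\<close>.\<close>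

lemma exists_stream_function:
  assumes "C1 v" and "\<And>x. divergence v x = 0"
  shows "\<exists>u. stream_function u v"
proof -
  let ?G = "\<lambda>x. - perp (v x)"
  have "partial_deriv i ?G x $ j = partial_deriv j ?G x $ i" for x and i j :: 2
    using assms(2)[of x] exhaust_2[of i] exhaust_2[of j]
    by (auto simp: partial_deriv_bounded_linear[OF assms(1) bounded_linear_neg_perp] divergence_def sum_2)
  then show ?thesis
    using symmetric_field_has_potential[OF C1_bounded_linear[OF assms(1) bounded_linear_neg_perp]]
    unfolding stream_function_iff by metis
qed

text \<open>The identity v . grad v = grad (|v|^2 / 2) + omega perp v, with omega the scalar curl,
  combined with the Euler equation; \<open>- perp v\<close> is the gradient of the stream
  function.\<close>

lemma bernoulli:
  assumes "C1 v" "stationary_euler v p"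
  shows "GDERIV (\<lambda>x. p x + (norm (v x))\<^sup>2 / 2) x :>
    (partial_deriv 1 v x $ 2 - partial_deriv 2 v x $ 1) *\<^sub>R (- perp (v x))"
proof -
  obtain gp where gp: "GDERIV p x :> gp" "advection v x = - gp"
    using assms(2) unfolding stationary_euler_def by blast
  note der = C1_has_derivative[OF assms(1), of x]
  have "GDERIV (\<lambda>x. (norm (v x))\<^sup>2 / 2) x :> (\<chi> i. v x \<bullet> partial_deriv i v x)"
  proof -
    from bounded_linear.has_derivative[OF bounded_linear_divide has_derivative_inner[OF der der], of 2]
    show ?thesis
      unfolding gderiv_def power2_norm_eq_inner
      by (simp add: inner_commute[of _ "v x"]) (simp add: inner_sum_right inner_vec_def[of _ "vec_lambda _"])
  qed
  from GDERIV_add[OF gp(1) this] have "GDERIV (\<lambda>x. p x + (norm (v x))\<^sup>2 / 2) x :>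
     - advection v x + (\<chi> i. v x \<bullet> partial_deriv i v x)" using gp(2) by simp
  moreover have "- advection v x + (\<chi> i. v x \<bullet> partial_deriv i v x) =
     (partial_deriv 1 v x $ 2 - partial_deriv 2 v x $ 1) *\<^sub>R (- perp (v x))"
    by (simp add: vec_eq_iff forall_2 advection_def sum_2 inner_vec_def algebra_simps)
  ultimately show ?thesis by simp
qed


section \<open>Existence of stagnation points, constancy on a connected critical set, and the
  conclusion\<close>

lemma exists_critical_point:
  fixes u :: "real^2 \<Rightarrow> real"
  assumes u: "\<And>x. GDERIV u x :> g x" and g: "continuous_on UNIV g"
    and fin: "integrable lborel (\<lambda>x. (norm (g x))\<^sup>2)"
  shows "\<exists>x. g x = 0"
proof (rule ccontr)
  assume no: "\<not> ?thesis"
  have "\<not> u x < u y" for x y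
  proof
    assume lt: "u x < u y"
    define e where "e = (u y - u x) / 2"
    have "e > 0" using lt by (simp add: e_def)
    then obtain K where K: "compact K" "cball 0 (max (norm x) (norm y)) \<subseteq> interior K"
      "\<And>x y. x \<in> frontier K \<Longrightarrow> y \<in> frontier K \<Longrightarrow> \<bar>u x - u y\<bar> \<le> e"
      using small_oscillation[OF u g fin, of e "max (norm x) (norm y)"] by blast
    have "x \<in> cball 0 (max (norm x) (norm y))" "y \<in> cball 0 (max (norm x) (norm y))" by auto
    then have xy: "x \<in> K" "y \<in> K" using K(2) interior_subset by blast+
    obtain a where a: "\<And>z. z \<in> K \<Longrightarrow> u a \<le> u z" "a \<in> frontier K"
      using gderiv_compact_min[OF u K(1)] xy no by blast
    obtain b where b: "\<And>z. z \<in> K \<Longrightarrow> u z \<le> u b" "b \<in> frontier K"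
      using gderiv_compact_max[OF u K(1)] xy no by blast
    show False
      using a(1)[OF xy(1)] b(1)[OF xy(2)] K(3)[OF a(2) b(2)] lt unfolding e_def by argo
  qed
  then have "u y \<le> u x" for x y by (simp add: not_less)
  then have "g x = 0" for x by (intro gderiv_eq_0_at_max[OF u]) simp
  then show False using no by blast
qed

text \<open>The image of a connected set with two distinct values contains a nondegenerate interval,
  which is not negligible.\<close>

lemma constant_on_connected_critical:
  fixes u :: "real^2 \<Rightarrow> real"
  assumes u: "\<And>x. GDERIV u x :> g x" and g: "C1 g" and "connected {x. g x = 0}"
    and "g x = 0" "g y = 0"
  shows "u x = u y"
proof (rule ccontr)
  assume "u x \<noteq> u y"
  then obtain a b where ab: "g a = 0" "g b = 0" "u a < u b"
    using assms(4,5) by (metis linorder_neqE)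
  have "continuous_on {x. g x = 0} u"
    using u has_derivative_continuous unfolding gderiv_def
    by (blast intro: continuous_at_imp_continuous_on)
  then have "connected (u ` {x. g x = 0})" using assms(3) connected_continuous_image by blast
  then have "cbox (u a) (u b) \<subseteq> u ` {x. g x = 0}"
    using ab connected_contains_Icc[of "u ` {x. g x = 0}" "u a" "u b"] by auto
  then have "negligible (cbox (u a) (u b))"
    using negligible_critical_values[OF u g] negligible_subset by blast
  then have "box (u a) (u b) = {}" by (simp only: negligible_interval)
  then show False using ab(3) by simp
qed

theorem theorem1p1:
  fixes v :: "real^2 \<Rightarrow> real^2" and p :: "real^2 \<Rightarrow> real"
  assumes "L2 v" and "C1 v" and "stationary_euler v p"
  shows "stagnation_set v \<noteq> {} \<and>
    (\<forall>u. stream_function u v \<and> stagnation_set v \<noteq> UNIV \<and> connected (stagnation_set v) \<longrightarrow>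
      (\<exists>\<sigma>\<in>{1, -1}. \<exists>c. \<exists>w. w = (\<lambda>x. \<sigma> * u x + c) \<and>
        (\<forall>x\<in>stagnation_set v. w x = 1) \<and> 1 \<in> range w \<and> (\<forall>y. w y \<le> 1) \<and>
        (\<exists>L::ereal. L < 1 \<and>
          ((\<lambda>x. ereal (w x)) \<longlongrightarrow> L) at_infinity \<and> (INF x. ereal (w x)) = L \<and>
          (\<exists>f::real \<Rightarrow> real. continuous_on {t. L < ereal t \<and> t \<le> 1} f \<and>
            (\<forall>x. w x \<in> {t. L < ereal t \<and> t \<le> 1} \<and> - laplacian w x = f (w x))))))"
proof (intro conjI allI impI; (elim conjE)?)
  define G where "G x = - perp (v x)" for x
  have C1G: "C1 G"
    unfolding G_def[abs_def] by (rule C1_bounded_linear[OF assms(2) bounded_linear_neg_perp])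
  have contG: "continuous_on UNIV G" by (rule C1_continuous[OF C1G])
  have fin: "integrable lborel (\<lambda>x. (norm (G x))\<^sup>2)"
    using assms(1) by (simp add: G_def L2_def)
  have S: "stagnation_set v = {x. G x = 0}" by (auto simp: stagnation_set_def G_def)
  have crit: "\<exists>x. G x = 0"
  proof -
    \<comment> \<open>The first claim comes without a stream function, so one is constructed; the
      second concerns a given one.\<close>
    obtain u where "stream_function u v"
      using exists_stream_function[OF assms(2)] assms(3) unfolding stationary_euler_def by blast
    then show ?thesis
      using exists_critical_point[OF _ contG fin] unfolding stream_function_iff G_def by blast
  qed
  then show "stagnation_set v \<noteq> {}" unfolding S by simp
  fix u assume "stream_function u v" and SU: "stagnation_set v \<noteq> UNIV" and conn: "connected (stagnation_set v)"
  then have u: "GDERIV u x :> G x" for x unfolding stream_function_iff G_def by blast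
  obtain s where s: "G s = 0" using crit by blast
  have const: "u x = u s" if "G x = 0" for x
    using constant_on_connected_critical[OF u C1G conn[unfolded S] that s] .
  obtain x0 where x0: "u x0 \<noteq> u s"
  proof (rule ccontr)
    assume "\<not> thesis"
    then have "u x = u s" for x using that by blast
    then have "u y \<le> u x" for x y by (metis order_refl)
    then have "G x = 0" for x by (intro gderiv_eq_0_at_max[OF u] always_eventually allI)
    then show False using SU S by simp
  qed
  \<comment> \<open>The sign puts \<open>w x0\<close> below 1. One such value suffices: the locale
    derives that 1 is the global maximum.\<close>
  define \<sigma> :: real where "\<sigma> = (if u x0 < u s then 1 else -1)"
  have \<sigma>: "\<sigma> \<in> {1, -1}" "\<sigma> \<noteq> 0" "\<bar>\<sigma>\<bar> = 1" "\<sigma> * \<sigma> = 1" by (auto simp: \<sigma>_def)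
  define c where "c = 1 - \<sigma> * u s"
  define w where "w x = \<sigma> * u x + c" for x
  define \<omega> where "\<omega> x = partial_deriv 1 v x $ 2 - partial_deriv 2 v x $ 1" for x
  define g where "g x = \<sigma> *\<^sub>R G x" for x
  have g0: "g x = 0 \<longleftrightarrow> G x = 0" for x using \<sigma> by (simp add: g_def)
  have C1g: "C1 g"
    unfolding g_def[abs_def] by (rule C1_bounded_linear[OF C1G bounded_linear_scaleR_right])
  have wg: "GDERIV w x :> g x" for x
  proof -
    have "GDERIV (\<lambda>x. \<sigma> * u x + c) x :> (\<sigma> *\<^sub>R G x + u x *\<^sub>R 0) + 0"
      by (intro GDERIV_add GDERIV_mult GDERIV_const u)
    then show ?thesis by (simp add: w_def[abs_def] g_def)
  qed
  have lap: "laplacian w x = \<sigma> * \<omega> x" for x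
  proof -
    have pw: "partial_deriv i w = (\<lambda>x. g x $ i)" for i
      using partial_deriv_eq[OF wg[unfolded gderiv_def]]
      by (auto simp: fun_eq_iff inner_commute[of "axis _ _"] simp flip: cart_eq_inner_axis)
    have "partial_deriv i (\<lambda>x. g x $ i) x = partial_deriv i g x $ i" for i
      by (rule partial_deriv_bounded_linear[OF C1g bounded_linear_vec_nth])
    moreover have "partial_deriv i g x = \<sigma> *\<^sub>R (- perp (partial_deriv i v x))" for i
      unfolding g_def[abs_def] partial_deriv_bounded_linear[OF C1G bounded_linear_scaleR_right]
      unfolding G_def[abs_def] partial_deriv_bounded_linear[OF assms(2) bounded_linear_neg_perp] ..
    ultimately show ?thesis
      by (simp add: laplacian_def pw sum_2 \<omega>_def algebra_simps)
  qed
  define h where "h x = p x + (norm (v x))\<^sup>2 / 2" for x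
  interpret single_peak w h "\<lambda>x. \<sigma> * \<omega> x" g
  proof
    show "GDERIV w x :> g x" for x by (rule wg)
    show "GDERIV h x :> (\<sigma> * \<omega> x) *\<^sub>R g x" for x
    proof -
      \<comment> \<open>The sign enters the vorticity and the gradient alike and cancels, so the
        same Bernoulli function serves both signs.\<close>
      have "(\<sigma> * \<omega> x) *\<^sub>R g x = \<omega> x *\<^sub>R G x"
        using \<sigma>(4) by (simp add: g_def mult.commute mult.left_commute)
      then show ?thesis
        using bernoulli[OF assms(2,3), of x] by (simp only: h_def[abs_def] \<omega>_def G_def)
    qed
    show "continuous_on UNIV g" by (rule C1_continuous[OF C1g])
    have "continuous_on UNIV (partial_deriv i v)" for i using assms(2) by (simp add: C1_def)
    then show "continuous_on UNIV (\<lambda>x. \<sigma> * \<omega> x)"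
      unfolding \<omega>_def by (intro continuous_intros)
    show "\<sigma> * \<omega> x = 0" if "x \<in> interior {x. g x = 0}" for x
    proof -
      have "v y = 0" if "y \<in> interior {x. g x = 0}" for y
      proof -
        have "g y = 0" using that interior_subset by blast
        then show ?thesis by (simp add: g0) (simp add: G_def)
      qed
      then have "(v has_derivative (\<lambda>_. 0)) (at x)"
        by (intro has_derivative_transform_within_open[OF has_derivative_const open_interior that]) auto
      then have "partial_deriv i v x = 0" for i using partial_deriv_eq by blast
      then show ?thesis by (simp add: \<omega>_def)
    qed
    show "\<exists>K. compact K \<and> cball 0 R \<subseteq> interior K \<and>
        (\<forall>x\<in>frontier K. \<forall>y\<in>frontier K. \<bar>w x - w y\<bar> \<le> \<eta>)" if "\<eta> > 0" for \<eta> R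
    proof -
      have "\<bar>w x - w y\<bar> = \<bar>u x - u y\<bar>" for x y
        using \<sigma>(3) by (simp add: w_def abs_mult flip: right_diff_distrib)
      then show ?thesis using small_oscillation[OF u contG fin that] by simp
    qed
    show "connected {x. g x = 0}" using conn by (simp add: S g0)
    show "\<exists>x. g x = 0" using crit by (simp add: g0)
    show "w x = 1" if "g x = 0" for x using const that by (simp add: w_def c_def g0)
    show "\<exists>x. w x < 1" using x0 by (intro exI[of _ x0]) (auto simp: w_def c_def \<sigma>_def)
  qed
  obtain f where f: "continuous_on {t. L < ereal t \<and> t \<le> 1} f" "\<And>x. \<sigma> * \<omega> x = f (w x)"
    using W_function_of_w by blast
  show "\<exists>\<sigma>\<in>{1, -1}. \<exists>c. \<exists>w. w = (\<lambda>x. \<sigma> * u x + c) \<and>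
        (\<forall>x\<in>stagnation_set v. w x = 1) \<and> 1 \<in> range w \<and> (\<forall>y. w y \<le> 1) \<and>
        (\<exists>L::ereal. L < 1 \<and>
          ((\<lambda>x. ereal (w x)) \<longlongrightarrow> L) at_infinity \<and> (INF x. ereal (w x)) = L \<and>
          (\<exists>f::real \<Rightarrow> real. continuous_on {t. L < ereal t \<and> t \<le> 1} f \<and>
            (\<forall>x. w x \<in> {t. L < ereal t \<and> t \<le> 1} \<and> - laplacian w x = f (w x))))"
  \<comment> \<open>The locale yields \<open>laplacian w x = f (w x)\<close>, so the nonlinearity
    asked for is \<open>- f\<close>.\<close>
  proof (intro bexI[OF _ \<sigma>(1)] exI[of _ c] exI[of _ w] exI[of _ L] exI[of _ "\<lambda>t. - f t"]
      conjI ballI allI)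
    show "w = (\<lambda>x. \<sigma> * u x + c)" by (simp add: w_def fun_eq_iff)
    show "w x = 1" if "x \<in> stagnation_set v" for x using that peak by (simp add: S g0)
    show "1 \<in> range w" using critical peak by (metis rangeI)
    show "w y \<le> 1" for y by (rule le_1)
    show "L < 1" by (rule L_less_1)
    show "((\<lambda>x. ereal (w x)) \<longlongrightarrow> L) at_infinity" by (rule tendsto_L)
    show "(INF x. ereal (w x)) = L" by (simp add: L_def)
    show "continuous_on {t. L < ereal t \<and> t \<le> 1} (\<lambda>t. - f t)" by (intro continuous_intros f)
    show "w x \<in> {t. L < ereal t \<and> t \<le> 1}" for x using L_less le_1 by simp
    show "- laplacian w x = - f (w x)" for x by (simp add: lap f)
  qed
qed

end
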